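(* Let $d\geq 3$ and let $\mathcal{F}=V(x^d+y^d+z^d)\subset\mathbb{P}^2$ be the Fermat curve of degree $d$ over $\mathbb{C}$. Let $\mathcal{B}=V\left((x^d-y^d)(y^d-z^d)(z^d-x^d)\right)$, a union of $3d$ lines. Let $L$ be any line in $\mathcal{B}$, and consider the $d$ sextactic points of $\mathcal{F}$ lying on $L$. Then the $d$ hyperosculating conics to $\mathcal{F}$ at these points have two common intersection points when $d>3$, and one common intersection point when $d=3$ (that is, the set of points lying on all $d$ conics has two, respectively one, elements).
   Context: The osculating conic $O_p$ to $\mathcal{F}$ at $p$ is the unique conic with intersection multiplicity $(O_p.\mathcal{F})_p\geq 5$; it is hyperosculating if $(O_p.\mathcal{F})_p\geq 6$. An inflection point is a point $p$ whose tangent line meets $\mathcal{F}$ at $p$ with multiplicity at least $3$. A sextactic point is a point of $\mathcal{F}$ that is not an inflection point and at which the osculating conic is hyperosculating. Each line in $\mathcal{B}$ contains exactly $d$ sextactic points of $\mathcal{F}$. *)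

theory Defs
  imports
    Complex_Main
    "HOL-Library.Extended_Nat"
    "HOL-Computational_Algebra.Polynomial"
    "HOL-Computational_Algebra.Fraction_Field"
begin

(* The complex projective plane: nonzero triples up to nonzero scalars. *)

definition proj_rel :: "complex \<times> complex \<times> complex \<Rightarrow> complex \<times> complex \<times> complex \<Rightarrow> bool" where
  "proj_rel = (\<lambda>(x, y, z) (x', y', z').
     (x, y, z) \<noteq> (0, 0, 0) \<and> (\<exists>c. c \<noteq> 0 \<and> x' = c * x \<and> y' = c * y \<and> z' = c * z))"

quotient_type proj_plane = "complex \<times> complex \<times> complex" / partial: proj_rel
proof (rule part_equivpI)
  show "\<exists>v. proj_rel v v"
    by (rule exI[of _ "(1, 0, 0)"]) (auto simp: proj_rel_def intro: exI[of _ 1])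
  show "symp proj_rel"
  proof (rule sympI, clarify)
    fix x y z x' y' z'
    assume "proj_rel (x, y, z) (x', y', z')"
    then obtain c where "(x, y, z) \<noteq> (0, 0, 0)" "c \<noteq> 0"
      "x' = c * x" "y' = c * y" "z' = c * z"
      by (auto simp: proj_rel_def)
    then show "proj_rel (x', y', z') (x, y, z)"
      by (auto simp: proj_rel_def intro!: exI[of _ "inverse c"])
  qed
  show "transp proj_rel"
  proof (rule transpI, clarify)
    fix x y z x' y' z' x'' y'' z''
    assume "proj_rel (x, y, z) (x', y', z')" "proj_rel (x', y', z') (x'', y'', z'')"
    then obtain c c' where "(x, y, z) \<noteq> (0, 0, 0)" "c \<noteq> 0" "c' \<noteq> 0"
      "x' = c * x" "y' = c * y" "z' = c * z" "x'' = c' * x'" "y'' = c' * y'" "z'' = c' * z'"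
      by (auto simp: proj_rel_def)
    then show "proj_rel (x, y, z) (x'', y'', z'')"
      by (auto simp: proj_rel_def intro!: exI[of _ "c' * c"])
  qed
qed

(* (x : y : z) are homogeneous coordinates of P; in particular they do not all vanish. *)
definition has_coords :: "proj_plane \<Rightarrow> complex \<Rightarrow> complex \<Rightarrow> complex \<Rightarrow> bool" where
  "has_coords P x y z \<longleftrightarrow> (x, y, z) \<noteq> (0, 0, 0) \<and> P = abs_proj_plane (x, y, z)"

(* C[x,y,z] is represented as ((C[x])[y])[z]: the outermost variable is z. *)
type_synonym poly3 = "complex poly poly poly"

definition const3 :: "complex \<Rightarrow> poly3" where
  "const3 c = [:[:[:c:]:]:]"

definition varx :: poly3 where "varx = [:[:[:0, 1:]:]:]"
definition vary :: poly3 where "vary = [:[:0, 1:]:]"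
definition varz :: poly3 where "varz = [:0, 1:]"

definition eval3 :: "poly3 \<Rightarrow> complex \<Rightarrow> complex \<Rightarrow> complex \<Rightarrow> complex" where
  "eval3 F x y z = poly (poly (poly F [:[:z:]:]) [:y:]) x"

definition homogeneous3 :: "nat \<Rightarrow> poly3 \<Rightarrow> bool" where
  "homogeneous3 n F \<longleftrightarrow> (\<forall>i j k. coeff (coeff (coeff F k) j) i \<noteq> 0 \<longrightarrow> i + j + k = n)"

definition deriv_x :: "poly3 \<Rightarrow> poly3" where "deriv_x F = map_poly (map_poly pderiv) F"
definition deriv_y :: "poly3 \<Rightarrow> poly3" where "deriv_y F = map_poly pderiv F"
definition deriv_z :: "poly3 \<Rightarrow> poly3" where "deriv_z F = pderiv F"

(* Plane curves (lines, conics, ...) are given by their equation, a nonzero form, which is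
   determined up to a nonzero constant.  Reducible and non-reduced forms are allowed. *)

definition is_curve :: "nat \<Rightarrow> poly3 \<Rightarrow> bool" where
  "is_curve n F \<longleftrightarrow> F \<noteq> 0 \<and> homogeneous3 n F"

abbreviation is_line :: "poly3 \<Rightarrow> bool" where "is_line \<equiv> is_curve 1"
abbreviation is_conic :: "poly3 \<Rightarrow> bool" where "is_conic \<equiv> is_curve 2"

definition same_curve :: "poly3 \<Rightarrow> poly3 \<Rightarrow> bool" where
  "same_curve F G \<longleftrightarrow> (\<exists>c. c \<noteq> 0 \<and> G = const3 c * F)"

(* Used for forms only, where vanishing does not depend on the choice of coordinates. *)
definition V :: "poly3 \<Rightarrow> proj_plane set" where
  "V F = {P. \<exists>x y z. has_coords P x y z \<and> eval3 F x y z = 0}"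

(* The local ring of the projective plane at P, inside the field C(x,y,z): quotients of two
   forms of equal degree whose denominator does not vanish at P. *)
definition local_ring :: "proj_plane \<Rightarrow> poly3 fract set" where
  "local_ring P = {Fract A B | A B n. homogeneous3 n A \<and> homogeneous3 n B \<and> P \<notin> V B}"

(* The ideal of the curve F in the local ring at P. *)
definition local_ideal :: "proj_plane \<Rightarrow> poly3 \<Rightarrow> poly3 fract set" where
  "local_ideal P F =
     {Fract A B | A B n. homogeneous3 n A \<and> homogeneous3 n B \<and> P \<notin> V B \<and> F dvd A}"

(* Linear independence over C of the classes of r 0, ..., r (n-1) modulo I. *)
definition indep_mod :: "poly3 fract set \<Rightarrow> nat \<Rightarrow> (nat \<Rightarrow> poly3 fract) \<Rightarrow> bool" where
  "indep_mod I n r \<longleftrightarrow>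
     (\<forall>c. (\<Sum>i<n. Fract (const3 (c i)) 1 * r i) \<in> I \<longrightarrow> (\<forall>i<n. c i = 0))"

(* (F.G)_P, the dimension over C of the local ring at P modulo the ideals of F and G;
   it is infinite if F and G have a common component through P. *)
definition intersection_mult :: "poly3 \<Rightarrow> poly3 \<Rightarrow> proj_plane \<Rightarrow> enat" where
  "intersection_mult F G P = Sup {enat n | n. \<exists>r. (\<forall>i<n. r i \<in> local_ring P) \<and>
     indep_mod {a + b | a b. a \<in> local_ideal P F \<and> b \<in> local_ideal P G} n r}"

(* The equation of the tangent line to F at the point (a : b : c) of F.  It is the zero
   polynomial at a singular point. *)
definition tangent_line :: "poly3 \<Rightarrow> complex \<Rightarrow> complex \<Rightarrow> complex \<Rightarrow> poly3" where
  "tangent_line F a b c =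
     const3 (eval3 (deriv_x F) a b c) * varx + const3 (eval3 (deriv_y F) a b c) * vary +
     const3 (eval3 (deriv_z F) a b c) * varz"

definition inflection_point :: "poly3 \<Rightarrow> proj_plane \<Rightarrow> bool" where
  "inflection_point F P \<longleftrightarrow> P \<in> V F \<and>
     (\<exists>a b c. has_coords P a b c \<and> tangent_line F a b c \<noteq> 0 \<and>
        intersection_mult (tangent_line F a b c) F P \<ge> 3)"

definition osculating_conic :: "poly3 \<Rightarrow> proj_plane \<Rightarrow> poly3 \<Rightarrow> bool" where
  "osculating_conic F P Q \<longleftrightarrow> is_conic Q \<and> intersection_mult Q F P \<ge> 5 \<and>
     (\<forall>Q'. is_conic Q' \<and> intersection_mult Q' F P \<ge> 5 \<longrightarrow> same_curve Q Q')"

definition hyperosculating_conic :: "poly3 \<Rightarrow> proj_plane \<Rightarrow> poly3 \<Rightarrow> bool" where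
  "hyperosculating_conic F P Q \<longleftrightarrow> osculating_conic F P Q \<and> intersection_mult Q F P \<ge> 6"

definition sextactic_point :: "poly3 \<Rightarrow> proj_plane \<Rightarrow> bool" where
  "sextactic_point F P \<longleftrightarrow>
     P \<in> V F \<and> \<not> inflection_point F P \<and> (\<exists>Q. hyperosculating_conic F P Q)"

definition fermat :: "nat \<Rightarrow> poly3" where
  "fermat d = varx ^ d + vary ^ d + varz ^ d"

definition fermat_arrangement :: "nat \<Rightarrow> poly3" where
  "fermat_arrangement d =
     (varx ^ d - vary ^ d) * (vary ^ d - varz ^ d) * (varz ^ d - varx ^ d)"

definition sextactic_points_on :: "nat \<Rightarrow> poly3 \<Rightarrow> proj_plane set" where
  "sextactic_points_on d L = {P \<in> V L. sextactic_point (fermat d) P}"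

end

theory Submission
  imports Defs
begin

text \<open>
  Write the line as \<open>X = Y\<close>, where \<open>X, Y, Z\<close> are the coordinates up to order and \<open>d\<close>-th roots of
  unity, and put \<open>X = S + T\<close>, \<open>Y = S - T\<close>. The curve meets the line in the points
  \<open>(S : T : Z) = (1 : 0 : w)\<close> with \<open>w^d = -2\<close>. Near such a point the curve is \<open>S = 1\<close>, \<open>T = t\<close>,
  \<open>Z = w (1 + a t^2 + b t^4 + O(t^6))\<close>, an even function of \<open>t\<close>, so with \<open>W = Z / w - S\<close> the conic
  \<open>S W - a T^2 + k W^2 = 0\<close>, \<open>k = - b / a^2\<close>, which is even in \<open>T\<close> and meets the curve to order \<open>5\<close>,
  automatically meets it to order \<open>6\<close>. No line meets the curve to order \<open>3\<close> there because \<open>a\<close> is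
  nonzero. At a fixed point of the plane the equation of the conic is a quadratic polynomial in \<open>1 / w\<close>;
  it vanishes at \<open>d \<ge> 3\<close> values only if its coefficients do, that is, if \<open>Z = 0\<close> and
  \<open>(k - 1) S^2 = a T^2\<close>. These are two points unless \<open>k = 1\<close>, which means \<open>d = 3\<close>.
  Orders of contact are computed from the expansion of a local function in powers of \<open>T / S\<close>
  modulo the equation of the curve.
\<close>

section \<open>Forms\<close>

lemma eval3_simps [simp]:
  "eval3 0 x y z = 0"
  "eval3 (A + B) x y z = eval3 A x y z + eval3 B x y z"
  "eval3 (A - B) x y z = eval3 A x y z - eval3 B x y z"
  "eval3 (- A) x y z = - eval3 A x y z"
  "eval3 (A * B) x y z = eval3 A x y z * eval3 B x y z"
  "eval3 (A ^ n) x y z = eval3 A x y z ^ n"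
  "eval3 (const3 c) x y z = c"
  "eval3 varx x y z = x" "eval3 vary x y z = y" "eval3 varz x y z = z"
  by (simp_all add: eval3_def const3_def varx_def vary_def varz_def)

lemma const3_simps:
  "const3 0 = 0" "const3 1 = 1" "const3 (a + b) = const3 a + const3 b"
  "const3 (a * b) = const3 a * const3 b" "const3 (- a) = - const3 a"
  "const3 (a - b) = const3 a - const3 b"
  by (simp_all add: const3_def one_pCons)

lemma const3_power: "const3 (a ^ n) = const3 a ^ n"
  by (induction n) (simp_all add: const3_simps)

lemma const3_of_nat: "const3 (of_nat n) = of_nat n"
  by (induction n) (simp_all add: const3_simps)

text \<open>An inductive twin of \<open>homogeneous3\<close>: rule induction replaces coefficient
  bookkeeping when products and scaling are treated. The two notions are identified in
  \<open>homogeneous3_iff_form\<close>.\<close>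

inductive form :: "nat \<Rightarrow> poly3 \<Rightarrow> bool" where
  form_const: "form 0 (const3 c)"
| form_zero: "form n 0"
| form_add: "form n A \<Longrightarrow> form n B \<Longrightarrow> form n (A + B)"
| form_varx: "form n A \<Longrightarrow> form (Suc n) (varx * A)"
| form_vary: "form n A \<Longrightarrow> form (Suc n) (vary * A)"
| form_varz: "form n A \<Longrightarrow> form (Suc n) (varz * A)"

lemma coeff_var_mult:
  "coeff (coeff (coeff (varx * A) k) j) i =
     (case i of 0 \<Rightarrow> 0 | Suc i' \<Rightarrow> coeff (coeff (coeff A k) j) i')"
  "coeff (coeff (coeff (vary * A) k) j) i =
     (case j of 0 \<Rightarrow> 0 | Suc j' \<Rightarrow> coeff (coeff (coeff A k) j') i)"
  "coeff (coeff (coeff (varz * A) k) j) i =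
     (case k of 0 \<Rightarrow> 0 | Suc k' \<Rightarrow> coeff (coeff (coeff A k') j) i)"
  by (simp_all add: varx_def vary_def varz_def coeff_pCons split: nat.split)

lemma form_imp_homogeneous3: "form n A \<Longrightarrow> homogeneous3 n A"
proof (induction rule: form.induct)
  case (form_add n A B)
  then show ?case
    unfolding homogeneous3_def by (metis add.right_neutral coeff_add)
qed (fastforce simp: homogeneous3_def coeff_var_mult const3_def coeff_pCons split: nat.splits)+

text \<open>The three nested polynomial layers are treated one at a time, innermost first. Splitting
  off the lowest coefficient leaves a variable times a form of degree one less; in degree 0 that
  remainder has to vanish.\<close>

lemma form_const_const:
  "homogeneous3 n [:[:r:]:] \<Longrightarrow> form n [:[:r:]:]"
proof (induction r arbitrary: n)
  case 0
  then show ?case by (simp add: form_zero)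
next
  case (pCons c r)
  have eq: "[:[:pCons c r:]:] = const3 c + varx * [:[:r:]:]"
    by (simp add: const3_def varx_def)
  have "form n (const3 c)"
  proof (cases "c = 0")
    case False
    then have "n = 0"
      using pCons.prems unfolding homogeneous3_def
      by (metis add.right_neutral coeff_pCons_0)
    then show ?thesis by (simp add: form_const)
  qed (simp add: const3_def form_zero)
  moreover have "form n (varx * [:[:r:]:])"
  proof (cases n)
    case 0
    have "r = 0"
    proof (rule poly_eqI)
      fix i
      show "coeff r i = coeff 0 i"
        using pCons.prems 0 unfolding homogeneous3_def
        by (metis Suc_neq_Zero add_is_0 coeff_0 coeff_pCons_0 coeff_pCons_Suc)
    qed
    then show ?thesis by (simp add: form_zero)
  next
    case (Suc m)
    have "homogeneous3 m [:[:r:]:]"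
      unfolding homogeneous3_def
    proof (intro allI impI)
      fix i j k
      assume "coeff (coeff (coeff [:[:r:]:] k) j) i \<noteq> 0"
      then have "coeff (coeff (coeff [:[:pCons c r:]:] k) j) (Suc i) \<noteq> 0"
        by (simp add: coeff_pCons split: nat.splits)
      then show "i + j + k = m"
        using pCons.prems Suc unfolding homogeneous3_def by fastforce
    qed
    then show ?thesis using pCons.IH Suc form_varx by blast
  qed
  ultimately show ?case unfolding eq by (rule form_add)
qed

lemma form_const_poly:
  "homogeneous3 n [:q:] \<Longrightarrow> form n [:q:]"
proof (induction q arbitrary: n)
  case 0
  then show ?case by (simp add: form_zero)
next
  case (pCons r q)
  have eq: "[:pCons r q:] = [:[:r:]:] + vary * [:q:]"
    by (simp add: vary_def)
  have "homogeneous3 n [:[:r:]:]"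
    using pCons.prems unfolding homogeneous3_def
    by (fastforce simp: coeff_pCons split: nat.splits)
  then have "form n [:[:r:]:]"
    by (rule form_const_const)
  moreover have "form n (vary * [:q:])"
  proof (cases n)
    case 0
    have "q = 0"
    proof (intro poly_eqI)
      fix j i
      show "coeff (coeff q j) i = coeff (coeff 0 j) i"
        using pCons.prems 0 unfolding homogeneous3_def
        by (metis Suc_neq_Zero add_is_0 coeff_0 coeff_pCons_0 coeff_pCons_Suc)
    qed
    then show ?thesis by (simp add: form_zero)
  next
    case (Suc m)
    have "homogeneous3 m [:q:]"
      unfolding homogeneous3_def
    proof (intro allI impI)
      fix i j k
      assume "coeff (coeff (coeff [:q:] k) j) i \<noteq> 0"
      then have "coeff (coeff (coeff [:pCons r q:] k) (Suc j)) i \<noteq> 0"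
        by (simp add: coeff_pCons split: nat.splits)
      then show "i + j + k = m"
        using pCons.prems Suc unfolding homogeneous3_def by fastforce
    qed
    then show ?thesis using pCons.IH Suc form_vary by blast
  qed
  ultimately show ?case unfolding eq by (rule form_add)
qed

lemma homogeneous3_imp_form:
  "homogeneous3 n A \<Longrightarrow> form n A"
proof (induction A arbitrary: n)
  case 0
  then show ?case by (simp add: form_zero)
next
  case (pCons q A)
  have eq: "pCons q A = [:q:] + varz * A"
    by (simp add: varz_def)
  have "homogeneous3 n [:q:]"
    using pCons.prems unfolding homogeneous3_def
    by (fastforce simp: coeff_pCons split: nat.splits)
  then have "form n [:q:]"
    by (rule form_const_poly)
  moreover have "form n (varz * A)"
  proof (cases n)
    case 0
    have "A = 0"
    proof (intro poly_eqI)
      fix k j i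
      show "coeff (coeff (coeff A k) j) i = coeff (coeff (coeff 0 k) j) i"
        using pCons.prems 0 unfolding homogeneous3_def
        by (metis Suc_neq_Zero add_is_0 coeff_0 coeff_pCons_Suc)
    qed
    then show ?thesis by (simp add: form_zero)
  next
    case (Suc m)
    have "homogeneous3 m A"
      unfolding homogeneous3_def
    proof (intro allI impI)
      fix i j k
      assume "coeff (coeff (coeff A k) j) i \<noteq> 0"
      then have "coeff (coeff (coeff (pCons q A) (Suc k)) j) i \<noteq> 0"
        by simp
      then show "i + j + k = m"
        using pCons.prems Suc unfolding homogeneous3_def by fastforce
    qed
    then show ?thesis using pCons.IH Suc form_varz by blast
  qed
  ultimately show ?case unfolding eq by (rule form_add)
qed

lemma homogeneous3_iff_form: "homogeneous3 = form"
  using form_imp_homogeneous3 homogeneous3_imp_form by blast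

lemma form_mult: "form m A \<Longrightarrow> form n B \<Longrightarrow> form (m + n) (A * B)"
proof (induction rule: form.induct)
  case (form_const c)
  show ?case using form_const.prems
  proof (induction rule: form.induct)
    case (form_const c')
    then show ?case using form.form_const[of "c * c'"] by (simp add: const3_simps)
  qed (auto simp: distrib_left mult.left_commute[of "const3 c"] intro: form.intros)
qed (auto simp: distrib_right mult.assoc intro: form.intros)

lemma homogeneous3_0 [simp, intro]: "homogeneous3 n 0"
  and homogeneous3_const [simp, intro]: "homogeneous3 0 (const3 c)"
  and homogeneous3_add: "homogeneous3 n A \<Longrightarrow> homogeneous3 n B \<Longrightarrow> homogeneous3 n (A + B)"
  and homogeneous3_mult: "homogeneous3 m A \<Longrightarrow> homogeneous3 k B \<Longrightarrow> homogeneous3 (m + k) (A * B)"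
  by (simp_all add: homogeneous3_iff_form form_mult form.intros)

lemma homogeneous3_var [simp, intro]:
  "homogeneous3 (Suc 0) varx" "homogeneous3 (Suc 0) vary" "homogeneous3 (Suc 0) varz"
  using form_varx[OF form_const[of 1]] form_vary[OF form_const[of 1]] form_varz[OF form_const[of 1]]
  by (simp_all add: homogeneous3_iff_form const3_simps)

lemma homogeneous3_const_mult: "homogeneous3 n A \<Longrightarrow> homogeneous3 n (const3 c * A)"
  using homogeneous3_mult[of 0 "const3 c" n A] by simp

lemma homogeneous3_uminus: "homogeneous3 n A \<Longrightarrow> homogeneous3 n (- A)"
  by (simp add: homogeneous3_def)

lemma homogeneous3_diff: "homogeneous3 n A \<Longrightarrow> homogeneous3 n B \<Longrightarrow> homogeneous3 n (A - B)"
  using homogeneous3_add[of n A "- B"] by (simp add: homogeneous3_uminus)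

lemma homogeneous3_power: "homogeneous3 n A \<Longrightarrow> homogeneous3 (k * n) (A ^ k)"
  by (induction k) (auto simp: homogeneous3_mult const3_simps(2)[symmetric])

lemma homogeneous3_sum:
  "(\<And>i. i \<in> I \<Longrightarrow> homogeneous3 n (A i)) \<Longrightarrow> homogeneous3 n (sum A I)"
  by (induction I rule: infinite_finite_induct) (auto simp: homogeneous3_add)

lemma eval3_scale:
  assumes "homogeneous3 n A"
  shows "eval3 A (c * x) (c * y) (c * z) = c ^ n * eval3 A x y z"
  using assms[unfolded homogeneous3_iff_form]
  by (induction rule: form.induct) (simp_all add: algebra_simps)

section \<open>Points\<close>

lemma has_coords_scale:
  assumes "has_coords P x y z" "c \<noteq> 0"
  shows "has_coords P (c * x) (c * y) (c * z)"
proof -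
  have "proj_rel (x, y, z) (c * x, c * y, c * z)"
    using assms by (auto simp: has_coords_def proj_rel_def)
  then have "abs_proj_plane (x, y, z) = abs_proj_plane (c * x, c * y, c * z)"
    by (metis Quotient_proj_plane Quotient_rel_abs)
  then show ?thesis
    using assms by (auto simp: has_coords_def)
qed

lemma has_coords_unique:
  assumes "has_coords P x y z" "has_coords P x' y' z'"
  obtains c where "c \<noteq> 0" "x' = c * x" "y' = c * y" "z' = c * z"
proof -
  have "proj_rel (x, y, z) (x, y, z)" "proj_rel (x', y', z') (x', y', z')"
    using assms by (auto simp: has_coords_def proj_rel_def intro: exI[of _ 1])
  moreover have "abs_proj_plane (x, y, z) = abs_proj_plane (x', y', z')"
    using assms by (simp add: has_coords_def)
  ultimately have "proj_rel (x, y, z) (x', y', z')"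
    using Quotient_rel[OF Quotient_proj_plane] by blast
  then show ?thesis
    using that by (auto simp: proj_rel_def)
qed

lemma has_coords_exists:
  obtains x y z where "has_coords P x y z"
proof -
  obtain x y z where r: "rep_proj_plane P = (x, y, z)"
    by (cases "rep_proj_plane P")
  have "proj_rel (x, y, z) (x, y, z)" "abs_proj_plane (x, y, z) = P"
    using Quotient_rep_reflp[OF Quotient_proj_plane, of P]
      Quotient_abs_rep[OF Quotient_proj_plane, of P] by (simp_all add: r)
  then have "has_coords P x y z"
    by (auto simp: has_coords_def proj_rel_def)
  then show ?thesis by (rule that)
qed

text \<open>Membership asks for some coordinates at which the form vanishes; by homogeneity any
  coordinates of the point will do.\<close>

lemma V_iff:
  assumes "homogeneous3 n A" "has_coords P x y z"
  shows "P \<in> V A \<longleftrightarrow> eval3 A x y z = 0"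
proof
  assume "P \<in> V A"
  then obtain x' y' z' where "has_coords P x' y' z'" "eval3 A x' y' z' = 0"
    by (auto simp: V_def)
  moreover from this(1) obtain c where "c \<noteq> 0" "x = c * x'" "y = c * y'" "z = c * z'"
    using assms(2) by (rule has_coords_unique)
  ultimately show "eval3 A x y z = 0"
    using eval3_scale[OF assms(1)] by simp
next
  assume "eval3 A x y z = 0"
  then show "P \<in> V A" using assms(2) by (auto simp: V_def)
qed

lemma V_mult_iff:
  assumes "homogeneous3 m A" "homogeneous3 n B"
  shows "P \<in> V (A * B) \<longleftrightarrow> P \<in> V A \<or> P \<in> V B"
proof -
  obtain x y z where P: "has_coords P x y z"
    by (rule has_coords_exists)
  show ?thesis
    using V_iff[OF homogeneous3_mult[OF assms] P] V_iff[OF assms(1) P] V_iff[OF assms(2) P]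
    by simp
qed

text \<open>As a simp rule this turns \<open>P \<notin> V B\<close> into
  \<open>B \<noteq> 0\<close>, which is how denominators are seen to be nonzero.\<close>

lemma V_0 [simp]: "P \<in> V 0"
  by (rule has_coords_exists[of P]) (auto simp: V_def)

section \<open>Local rings\<close>

definition ideal3 :: "poly3 set \<Rightarrow> bool" where
  "ideal3 J \<longleftrightarrow> 0 \<in> J \<and> (\<forall>A\<in>J. \<forall>B\<in>J. A + B \<in> J) \<and> (\<forall>A\<in>J. \<forall>B. B * A \<in> J)"

lemma ideal3_UNIV: "ideal3 UNIV"
  and ideal3_dvd: "ideal3 {A. F dvd A}"
  by (simp_all add: ideal3_def)

text \<open>One construction with three uses: all numerators give the local ring, multiples of
  \<open>F\<close> give the ideal of the curve, and numerators vanishing to a given order along an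
  arc give the filtration \<open>ord_ideal\<close> below.\<close>

definition fracs :: "proj_plane \<Rightarrow> poly3 set \<Rightarrow> poly3 fract set" where
  "fracs P J = {Fract A B | A B n. homogeneous3 n A \<and> homogeneous3 n B \<and> P \<notin> V B \<and> A \<in> J}"

lemma local_ring_eq: "local_ring P = fracs P UNIV"
  and local_ideal_eq: "local_ideal P F = fracs P {A. F dvd A}"
  by (simp_all add: local_ring_def local_ideal_def fracs_def)

lemma fracsI:
  "homogeneous3 n A \<Longrightarrow> homogeneous3 n B \<Longrightarrow> P \<notin> V B \<Longrightarrow> A \<in> J \<Longrightarrow> Fract A B \<in> fracs P J"
  by (auto simp: fracs_def)

lemma fracsE:
  assumes "r \<in> fracs P J"
  obtains A B n where "r = Fract A B" "homogeneous3 n A" "homogeneous3 n B" "P \<notin> V B" "A \<in> J" "B \<noteq> 0"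
  using assms by (force simp: fracs_def)

lemma fracs_mono: "J \<subseteq> K \<Longrightarrow> fracs P J \<subseteq> fracs P K"
  unfolding fracs_def by blast

lemma fracs_add:
  assumes "ideal3 J" "r \<in> fracs P J" "s \<in> fracs P J"
  shows "r + s \<in> fracs P J"
proof -
  obtain A B n where r: "r = Fract A B" "homogeneous3 n A" "homogeneous3 n B" "P \<notin> V B" "A \<in> J" "B \<noteq> 0"
    using assms(2) by (rule fracsE)
  obtain C D m where s: "s = Fract C D" "homogeneous3 m C" "homogeneous3 m D" "P \<notin> V D" "C \<in> J" "D \<noteq> 0"
    using assms(3) by (rule fracsE)
  have "r + s = Fract (D * A + B * C) (B * D)"
    using r s by (simp add: mult.commute)
  moreover have "homogeneous3 (n + m) (D * A + B * C)" "homogeneous3 (n + m) (B * D)"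
    using homogeneous3_mult[OF s(3) r(2)] homogeneous3_mult[OF r(3) s(2)] homogeneous3_mult[OF r(3) s(3)]
    by (auto intro: homogeneous3_add simp: add.commute)
  moreover have "P \<notin> V (B * D)"
    using V_mult_iff[OF r(3) s(3)] r s by simp
  moreover have "D * A + B * C \<in> J"
    using assms(1) r s by (auto simp: ideal3_def)
  ultimately show ?thesis by (auto intro: fracsI)
qed

lemma fracs_mult:
  assumes "ideal3 J" "r \<in> local_ring P" "s \<in> fracs P J"
  shows "r * s \<in> fracs P J"
proof -
  obtain A B n where r: "r = Fract A B" "homogeneous3 n A" "homogeneous3 n B" "P \<notin> V B"
    using assms(2) unfolding local_ring_eq by (rule fracsE)
  obtain C D m where s: "s = Fract C D" "homogeneous3 m C" "homogeneous3 m D" "P \<notin> V D" "C \<in> J"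
    using assms(3) by (rule fracsE)
  have "r * s = Fract (A * C) (B * D)"
    using r s by simp
  moreover have "P \<notin> V (B * D)"
    using V_mult_iff[OF r(3) s(3)] r s by simp
  moreover have "A * C \<in> J"
    using assms(1) s by (auto simp: ideal3_def)
  ultimately show ?thesis
    using homogeneous3_mult[OF r(2) s(2)] homogeneous3_mult[OF r(3) s(3)]
    by (auto intro: fracsI)
qed

abbreviation scalar :: "complex \<Rightarrow> poly3 fract" where
  "scalar c \<equiv> Fract (const3 c) 1"

lemma not_in_V_1: "P \<notin> V 1"
proof -
  obtain x y z where "has_coords P x y z" by (rule has_coords_exists)
  then show ?thesis
    using V_iff[OF homogeneous3_const[of 1]] by (simp add: const3_simps eval3_def)
qed

lemma homogeneous3_1 [simp, intro]: "homogeneous3 0 1"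
  using homogeneous3_const[of 1] by (simp add: const3_simps)

lemma scalar_in_local_ring: "scalar c \<in> local_ring P"
  unfolding local_ring_eq by (rule fracsI[OF _ homogeneous3_1]) (simp_all add: not_in_V_1)

lemma scalar_simps:
  "scalar (a + b) = scalar a + scalar b" "scalar (a * b) = scalar a * scalar b"
  "scalar 0 = 0" "scalar 1 = 1" "scalar (- a) = - scalar a"
  by (simp_all add: const3_simps Zero_fract_def One_fract_def)

lemma scalar_sum: "scalar (\<Sum>i\<in>I. f i) = (\<Sum>i\<in>I. scalar (f i))"
  by (induction I rule: infinite_finite_induct) (simp_all add: scalar_simps)

lemma fracs_0: "ideal3 J \<Longrightarrow> 0 \<in> fracs P J"
  unfolding Zero_fract_def by (rule fracsI[of 0]) (simp_all add: not_in_V_1 ideal3_def)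

lemma fracs_uminus: "ideal3 J \<Longrightarrow> r \<in> fracs P J \<Longrightarrow> - r \<in> fracs P J"
  using fracs_mult[of J "scalar (-1)" P r] scalar_in_local_ring[of "-1" P]
  by (simp add: scalar_simps(4,5) del: One_nat_def)

lemma fracs_sum:
  "ideal3 J \<Longrightarrow> (\<And>i. i \<in> I \<Longrightarrow> f i \<in> fracs P J) \<Longrightarrow> sum f I \<in> fracs P J"
  by (induction I rule: infinite_finite_induct) (auto intro: fracs_0 fracs_add)

lemma local_ring_closed:
  "r \<in> local_ring P \<Longrightarrow> s \<in> local_ring P \<Longrightarrow> r + s \<in> local_ring P"
  "r \<in> local_ring P \<Longrightarrow> s \<in> local_ring P \<Longrightarrow> r * s \<in> local_ring P"
  "r \<in> local_ring P \<Longrightarrow> - r \<in> local_ring P"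
  "0 \<in> local_ring P" "1 \<in> local_ring P"
  using scalar_in_local_ring[of 1 P] fracs_mult[OF ideal3_UNIV]
  by (simp_all add: local_ring_eq fracs_add fracs_uminus fracs_0 ideal3_UNIV scalar_simps)

lemma local_ring_sum:
  "(\<And>i. i \<in> I \<Longrightarrow> f i \<in> local_ring P) \<Longrightarrow> sum f I \<in> local_ring P"
  unfolding local_ring_eq by (rule fracs_sum[OF ideal3_UNIV])

section \<open>Linear dependence of more than \<open>k\<close> vectors with \<open>k\<close>
  coordinates\<close>

text \<open>Gaussian elimination, one coordinate per induction step. The index set is arbitrary
  because the pivot is removed from it. The lemma later bounds the number of classes independent
  modulo two curves.\<close>

lemma more_vectors_than_dimension:
  fixes v :: "'a \<Rightarrow> nat \<Rightarrow> 'b :: field"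
  assumes "finite I" "k < card I"
  shows "\<exists>e. (\<exists>i\<in>I. e i \<noteq> 0) \<and> (\<forall>l<k. (\<Sum>i\<in>I. e i * v i l) = 0)"
  using assms
proof (induction k arbitrary: I v)
  case 0
  then have "I \<noteq> {}" by auto
  then show ?case by (intro exI[of _ "\<lambda>_. 1"]) auto
next
  case (Suc k)
  show ?case
  proof (cases "\<forall>i\<in>I. v i k = 0")
    case True
    have "k < card I" using Suc.prems by simp
    from Suc.IH[OF Suc.prems(1) this, of v] obtain e where
      "\<exists>i\<in>I. e i \<noteq> 0" "\<forall>l<k. (\<Sum>i\<in>I. e i * v i l) = 0" by blast
    moreover have "(\<Sum>i\<in>I. e i * v i k) = 0" using True by simp
    ultimately show ?thesis by (metis less_antisym)
  next
    case False
    then obtain j where j: "j \<in> I" "v j k \<noteq> 0" by blast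
    define w where "w i l = v i l - v i k / v j k * v j l" for i l
    have "k < card (I - {j})" "finite (I - {j})" using Suc.prems j by auto
    from Suc.IH[OF this(2,1), of w] obtain e where
      e: "\<exists>i\<in>I - {j}. e i \<noteq> 0" "\<forall>l<k. (\<Sum>i\<in>I - {j}. e i * w i l) = 0" by blast
    \<comment> \<open>The pivot \<open>j\<close> receives the coefficient that cancels coordinate
      \<open>k\<close>; the other coordinates then agree with those of the reduced vectors
      \<open>w\<close>.\<close>
    define e' where "e' i = (if i = j then - (\<Sum>i\<in>I - {j}. e i * v i k) / v j k else e i)" for i
    have sum_e': "(\<Sum>i\<in>I. e' i * v i l) = (\<Sum>i\<in>I - {j}. e i * w i l)" for l
    proof -
      have "(\<Sum>i\<in>I. e' i * v i l) = e' j * v j l + (\<Sum>i\<in>I - {j}. e' i * v i l)"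
        using Suc.prems(1) j(1) by (rule sum.remove)
      also have "(\<Sum>i\<in>I - {j}. e' i * v i l) = (\<Sum>i\<in>I - {j}. e i * v i l)"
        by (rule sum.cong) (auto simp: e'_def)
      also have "e' j * v j l = - (\<Sum>i\<in>I - {j}. e i * (v i k / v j k * v j l))"
        by (simp add: e'_def sum_distrib_right sum_divide_distrib sum_negf mult.assoc)
      finally show ?thesis
        by (simp add: w_def right_diff_distrib sum_subtractf)
    qed
    have "\<exists>i\<in>I. e' i \<noteq> 0"
      using e(1) by (auto simp: e'_def)
    moreover have "(\<Sum>i\<in>I. e' i * v i l) = 0" if "l < Suc k" for l
    proof (cases "l = k")
      case True
      have "w i k = 0" for i using j(2) by (simp add: w_def)
      then show ?thesis using True sum_e'[of k] by simp
    next
      case False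
      then show ?thesis using that e(2) sum_e'[of l] by simp
    qed
    ultimately show ?thesis by blast
  qed
qed

section \<open>Pulling forms back along an arc\<close>

text \<open>The ring homomorphism from C[x,y,z] to C[t] that substitutes \<open>X\<close>,
  \<open>Y\<close>, \<open>Z\<close> for the variables, that is, restriction to the arc they
  parametrise.\<close>

definition pull :: "complex poly \<Rightarrow> complex poly \<Rightarrow> complex poly \<Rightarrow> poly3 \<Rightarrow> complex poly" where
  "pull X Y Z A = poly (map_poly (\<lambda>q. poly (map_poly (\<lambda>r. pcompose r X) q) Y) A) Z"

lemma poly_pull: "poly (pull X Y Z A) t = eval3 A (poly X t) (poly Y t) (poly Z t)"
proof -
  have inner: "poly (poly (map_poly (\<lambda>r. pcompose r X) q) Y) t = poly (poly q [:poly Y t:]) (poly X t)" for q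
    by (induction q) (simp_all add: map_poly_pCons poly_pcompose)
  show ?thesis
    unfolding pull_def eval3_def
    by (induction A) (simp_all add: map_poly_pCons inner)
qed

text \<open>A complex polynomial is determined by its values, so every law reduces to the one for
  evaluation through \<open>poly_pull\<close>.\<close>

lemma pull_simps [simp]:
  "pull X Y Z 0 = 0"
  "pull X Y Z (A + B) = pull X Y Z A + pull X Y Z B"
  "pull X Y Z (A - B) = pull X Y Z A - pull X Y Z B"
  "pull X Y Z (A * B) = pull X Y Z A * pull X Y Z B"
  "pull X Y Z (A ^ n) = pull X Y Z A ^ n"
  "pull X Y Z (const3 c) = [:c:]"
  "pull X Y Z varx = X" "pull X Y Z vary = Y" "pull X Y Z varz = Z"
  by (rule poly_ext; simp add: poly_pull)+

lemma pull_sum: "pull X Y Z (\<Sum>i\<in>I. f i) = (\<Sum>i\<in>I. pull X Y Z (f i))"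
  by (induction I rule: infinite_finite_induct) simp_all

lemma monom_dvd_monom: "m \<le> n \<Longrightarrow> monom (1 :: complex) m dvd monom 1 n"
  by (simp add: monom_1_dvd_iff')

text \<open>A factor that is nonzero at 0 does not contribute to the order of vanishing there. The
  induction strips off one factor t at a time.\<close>

lemma monom_dvd_mult_cancel:
  fixes u v :: "complex poly"
  assumes "monom 1 j dvd u * v" "poly v 0 \<noteq> 0"
  shows "monom 1 j dvd u"
  using assms(1)
proof (induction j)
  case (Suc j)
  have *: "monom (1::complex) (Suc j) = monom 1 j * [:0, 1:]"
    by (simp add: monom_altdef)
  have "monom 1 j dvd u * v"
    using Suc.prems unfolding * by (rule dvd_mult_left)
  then obtain w where w: "u = monom 1 j * w"
    using Suc.IH by (auto elim: dvdE)
  have "monom 1 j * [:0, 1:] dvd monom 1 j * (w * v)"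
    using Suc.prems unfolding * w by (simp only: mult.assoc)
  then have "[:0, 1:] dvd w * v"
    unfolding dvd_mult_cancel_left by simp
  then have "poly w 0 = 0"
    using assms(2) poly_eq_0_iff_dvd[of "w * v" 0] by simp
  then have "[:0, 1:] dvd w"
    using poly_eq_0_iff_dvd[of w 0] by simp
  then show ?case
    unfolding * w by (rule mult_dvd_mono[OF dvd_refl])
qed simp

section \<open>Linear coordinate systems and expansions of forms in them\<close>

text \<open>Spanning the three-dimensional space of linear forms, \<open>S\<close>,
  \<open>T\<close>, \<open>W\<close> are linear coordinates on the plane.\<close>

locale frame =
  fixes S T W :: poly3
  assumes homS: "homogeneous3 (Suc 0) S" and homT: "homogeneous3 (Suc 0) T"
    and homW: "homogeneous3 (Suc 0) W"
    and spanx: "\<exists>a b c. varx = const3 a * S + const3 b * T + const3 c * W"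
    and spany: "\<exists>a b c. vary = const3 a * S + const3 b * T + const3 c * W"
    and spanz: "\<exists>a b c. varz = const3 a * S + const3 b * T + const3 c * W"
begin

text \<open>Isolates the pure power of \<open>S\<close>, whose coefficient decides vanishing at the
  point T = W = 0. The cofactors of \<open>T\<close> and \<open>W\<close> have degree one less,
  hence the separate clause for degree 0.\<close>

definition splits :: "nat \<Rightarrow> poly3 \<Rightarrow> bool" where
  "splits n A \<longleftrightarrow> (\<exists>c A1 A2. A = const3 c * S ^ n + T * A1 + W * A2 \<and>
     (n = 0 \<and> A1 = 0 \<and> A2 = 0 \<or> (\<exists>m. n = Suc m \<and> homogeneous3 m A1 \<and> homogeneous3 m A2)))"

lemma splits_mult:
  assumes "U = const3 a * S + const3 b * T + const3 c * W" "splits n A" "homogeneous3 n A"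
  shows "splits (Suc n) (U * A)"
proof -
  obtain e A1 A2 where A: "A = const3 e * S ^ n + T * A1 + W * A2"
    and h: "n = 0 \<and> A1 = 0 \<and> A2 = 0 \<or> (\<exists>m. n = Suc m \<and> homogeneous3 m A1 \<and> homogeneous3 m A2)"
    using assms(2) by (auto simp: splits_def)
  have hS: "homogeneous3 n (S ^ n)"
    using homogeneous3_power[OF homS, of n] by simp
  have "homogeneous3 (Suc 0) U"
    unfolding assms(1) by (intro homogeneous3_add homogeneous3_const_mult homS homT homW)
  then have hU: "homogeneous3 n (U * A1)" "homogeneous3 n (U * A2)"
    using h homogeneous3_mult[of "Suc 0" U] by fastforce+
  have "U * A = const3 (a * e) * S ^ Suc n + T * (const3 (b * e) * S ^ n + U * A1)
      + W * (const3 (c * e) * S ^ n + U * A2)"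
  proof -
    have "U * A = U * (const3 e * S ^ n) + U * (T * A1 + W * A2)"
      unfolding A by (simp add: algebra_simps)
    also have "U * (const3 e * S ^ n) = (const3 a * S + const3 b * T + const3 c * W) * (const3 e * S ^ n)"
      by (simp only: assms(1))
    finally show ?thesis by (simp add: algebra_simps const3_simps)
  qed
  then show ?thesis
    unfolding splits_def using hU hS by (blast intro: homogeneous3_add homogeneous3_const_mult)
qed

lemma homogeneous3_splits:
  assumes "homogeneous3 n A"
  shows "splits n A"
  using assms[unfolded homogeneous3_iff_form]
proof (induction rule: form.induct)
  case (form_const c)
  show ?case by (auto simp: splits_def)
next
  case (form_zero n)
  show ?case unfolding splits_def
    by (rule exI[of _ 0], rule exI[of _ 0], rule exI[of _ 0]) (cases n; simp add: const3_simps)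
next
  case (form_add n A B)
  from form_add.IH(1) obtain c A1 A2 where A: "A = const3 c * S ^ n + T * A1 + W * A2"
    and hA: "n = 0 \<and> A1 = 0 \<and> A2 = 0 \<or> (\<exists>m. n = Suc m \<and> homogeneous3 m A1 \<and> homogeneous3 m A2)"
    by (auto simp: splits_def)
  from form_add.IH(2) obtain e B1 B2 where B: "B = const3 e * S ^ n + T * B1 + W * B2"
    and hB: "n = 0 \<and> B1 = 0 \<and> B2 = 0 \<or> (\<exists>m. n = Suc m \<and> homogeneous3 m B1 \<and> homogeneous3 m B2)"
    by (auto simp: splits_def)
  have "A + B = const3 (c + e) * S ^ n + T * (A1 + B1) + W * (A2 + B2)"
    by (simp add: A B algebra_simps const3_simps)
  moreover have "n = 0 \<and> A1 + B1 = 0 \<and> A2 + B2 = 0 \<or>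
      (\<exists>m. n = Suc m \<and> homogeneous3 m (A1 + B1) \<and> homogeneous3 m (A2 + B2))"
    using hA hB by (auto intro: homogeneous3_add)
  ultimately show ?case unfolding splits_def by blast
next
  case (form_varx n A)
  then show ?case using spanx splits_mult homogeneous3_iff_form by metis
next
  case (form_vary n A)
  then show ?case using spany splits_mult homogeneous3_iff_form by metis
next
  case (form_varz n A)
  then show ?case using spanz splits_mult homogeneous3_iff_form by metis
qed

lemma form0E:
  assumes "homogeneous3 0 A"
  obtains c where "A = const3 c"
  using homogeneous3_splits[OF assms] that by (auto simp: splits_def)

lemma form_SucE:
  assumes "homogeneous3 (Suc n) A"
  obtains c A1 A2 where "A = const3 c * S ^ Suc n + T * A1 + W * A2"
    "homogeneous3 n A1" "homogeneous3 n A2"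
  using homogeneous3_splits[OF assms] that by (auto simp: splits_def)

lemma linear_formE:
  assumes "homogeneous3 (Suc 0) A"
  obtains a b c where "A = const3 a * S + const3 b * T + const3 c * W"
proof -
  obtain c A1 A2 where A: "A = const3 c * S ^ Suc 0 + T * A1 + W * A2"
    "homogeneous3 0 A1" "homogeneous3 0 A2"
    using assms by (rule form_SucE)
  obtain a b where "A1 = const3 a" "A2 = const3 b"
    using form0E A(2,3) by metis
  then have "A = const3 c * S + const3 a * T + const3 b * W"
    by (simp add: A mult.commute)
  then show ?thesis by (rule that)
qed

lemma quadratic_formE:
  assumes "homogeneous3 2 A"
  obtains a b c e f g where "A = const3 a * S ^ 2 + const3 b * (S * T) + const3 c * (S * W) +
    const3 e * T ^ 2 + const3 f * (T * W) + const3 g * W ^ 2"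
proof -
  have "homogeneous3 (Suc (Suc 0)) A" using assms by (simp add: numeral_2_eq_2)
  then obtain c A1 A2 where A: "A = const3 c * S ^ Suc (Suc 0) + T * A1 + W * A2"
    "homogeneous3 (Suc 0) A1" "homogeneous3 (Suc 0) A2"
    by (rule form_SucE)
  obtain a1 b1 c1 where A1: "A1 = const3 a1 * S + const3 b1 * T + const3 c1 * W"
    using A(2) by (rule linear_formE)
  obtain a2 b2 c2 where A2: "A2 = const3 a2 * S + const3 b2 * T + const3 c2 * W"
    using A(3) by (rule linear_formE)
  have "A = const3 c * S ^ 2 + const3 a1 * (S * T) + const3 a2 * (S * W) +
    const3 b1 * T ^ 2 + const3 (c1 + b2) * (T * W) + const3 c2 * W ^ 2"
    by (simp add: A A1 A2 algebra_simps power2_eq_square const3_simps)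
  then show ?thesis by (rule that)
qed

end

section \<open>Intersection multiplicities at a smooth point\<close>

text \<open>The point \<open>P\<close> is T = W = 0. The equation \<open>F_eq\<close> with
  \<open>F2\<close> nonzero at \<open>P\<close> says that the curve is smooth there and that T / S
  is a local parameter. The polynomial arc, normalised to S = 1, T = t, satisfies the equation
  modulo t^N: a truncated branch suffices to compare contact orders up to \<open>N\<close>.\<close>

locale smooth_arc = frame S T W for S T W :: poly3 +
  fixes F F1 F2 :: poly3 and P :: proj_plane and X Y Z :: "complex poly" and d N :: nat
  assumes coords: "has_coords P (poly X 0) (poly Y 0) (poly Z 0)"
    and pullS: "pull X Y Z S = 1" and pullT: "pull X Y Z T = monom 1 1"
    and pullW: "poly (pull X Y Z W) 0 = 0"
    and F_eq: "F = T * F1 + W * F2"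
    and homF1: "homogeneous3 d F1" and homF2: "homogeneous3 d F2" and smooth: "P \<notin> V F2"
    and pullF: "monom 1 N dvd pull X Y Z F"
begin

abbreviation phi :: "poly3 \<Rightarrow> complex poly" where "phi \<equiv> pull X Y Z"

text \<open>The local parameter, which pulls back to t. Below, \<open>Fhat\<close> is the equation
  of the curve made into an element of the local ring by division by a power of
  \<open>S\<close>.\<close>

definition tau :: "poly3 fract" where "tau = Fract T S"

definition Fhat :: "poly3 fract" where "Fhat = Fract F (S ^ Suc d)"

definition ord_ideal :: "nat \<Rightarrow> poly3 set" where
  "ord_ideal j = {A. monom 1 j dvd phi A}"

lemma ideal3_ord_ideal: "ideal3 (ord_ideal j)"
  by (auto simp: ideal3_def ord_ideal_def)

lemma homF: "homogeneous3 (Suc d) F"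
  using homogeneous3_mult[OF homT homF1] homogeneous3_mult[OF homW homF2]
  by (simp add: F_eq homogeneous3_add)

lemma homS_power: "homogeneous3 n (S ^ n)"
  using homogeneous3_power[OF homS, of n] by simp

lemma in_V_iff: "homogeneous3 n A \<Longrightarrow> P \<in> V A \<longleftrightarrow> poly (phi A) 0 = 0"
  using V_iff[OF _ coords] by (simp add: poly_pull)

lemma S_power_not_in_V: "P \<notin> V (S ^ n)"
  using in_V_iff[OF homS_power] by (simp add: pullS)

lemma S_nonzero: "S \<noteq> 0"
  using S_power_not_in_V[of 1] by auto

lemma tau_in: "tau \<in> local_ring P"
  unfolding tau_def local_ring_eq
  using fracsI[OF homT homS] S_power_not_in_V[of 1] by simp

lemma tau_power: "tau ^ i = Fract (T ^ i) (S ^ i)"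
  by (induction i) (simp_all add: tau_def One_fract_def)

lemma tau_power_in: "tau ^ i \<in> local_ring P"
  by (induction i) (auto intro: local_ring_closed tau_in)

lemma Fract_sum: "B \<noteq> 0 \<Longrightarrow> (\<Sum>i\<in>I. Fract (f i) B) = Fract (\<Sum>i\<in>I. f i) (B :: poly3)"
  by (induction I rule: infinite_finite_induct)
    (simp_all add: Zero_fract_def eq_fract distrib_right[symmetric] mult.assoc[symmetric])

lemma tau_poly:
  "(\<Sum>i<m. scalar (c i) * tau ^ i) = Fract (\<Sum>i<m. const3 (c i) * T ^ i * S ^ (m - i)) (S ^ m)"
proof -
  have "scalar (c i) * tau ^ i = Fract (const3 (c i) * T ^ i * S ^ (m - i)) (S ^ m)" if "i < m" for i
  proof -
    have "S ^ m = S ^ (m - i) * S ^ i" using that by (simp flip: power_add)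
    then show ?thesis
      by (simp add: tau_power eq_fract S_nonzero mult_ac)
  qed
  then show ?thesis
    by (simp add: Fract_sum S_nonzero)
qed

text \<open>The order along the arc does not depend on the representing fraction: after cross
  multiplication the denominators pull back to polynomials that are nonzero at 0.\<close>

lemma dvd_if_in_ord_fracs:
  assumes "homogeneous3 n B" "P \<notin> V B" "Fract A B \<in> fracs P (ord_ideal j)"
  shows "monom 1 j dvd phi A"
proof -
  from assms(3) obtain C D m where CD: "Fract A B = Fract C D" "homogeneous3 m D" "P \<notin> V D"
    "C \<in> ord_ideal j" "D \<noteq> 0"
    by (rule fracsE)
  have "B \<noteq> 0" using assms(2) by auto
  then have "A * D = C * B"
    using CD by (simp add: eq_fract)
  then have "phi A * phi D = phi C * phi B"
    by (metis pull_simps(4))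
  then have "monom 1 j dvd phi A * phi D"
    using CD(4) by (simp add: ord_ideal_def)
  moreover have "poly (phi D) 0 \<noteq> 0"
    using in_V_iff CD by blast
  ultimately show ?thesis
    by (rule monom_dvd_mult_cancel)
qed

lemma tau_power_ord: "tau ^ j \<in> fracs P (ord_ideal j)"
proof -
  have "homogeneous3 j (T ^ j)" using homogeneous3_power[OF homT, of j] by simp
  then show ?thesis
    unfolding tau_power
    by (rule fracsI) (auto simp: homS_power S_power_not_in_V ord_ideal_def pullT monom_power)
qed

lemma Fhat_ord: "j \<le> N \<Longrightarrow> Fhat \<in> fracs P (ord_ideal j)"
  unfolding Fhat_def
  by (rule fracsI[OF homF homS_power S_power_not_in_V])
    (simp add: ord_ideal_def dvd_trans[OF monom_dvd_monom pullF])

text \<open>The combination has numerator pulling back to the sum of the \<open>c i\<close> t^i with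
  i < m, which t^m divides only if it is zero.\<close>

lemma tau_independent:
  assumes "(\<Sum>i<m. scalar (c i) * tau ^ i) \<in> fracs P (ord_ideal m)" "i < m"
  shows "c i = 0"
proof -
  have "monom 1 m dvd phi (\<Sum>i<m. const3 (c i) * T ^ i * S ^ (m - i))"
    using assms(1) unfolding tau_poly
    by (rule dvd_if_in_ord_fracs[OF homS_power S_power_not_in_V])
  also have "phi (\<Sum>i<m. const3 (c i) * T ^ i * S ^ (m - i)) = (\<Sum>i<m. monom (c i) i)"
    by (simp add: pull_sum pullS pullT monom_power smult_monom)
  finally have "coeff (\<Sum>i<m. monom (c i) i) i = 0"
    using assms(2) by (simp add: monom_1_dvd_iff')
  then show ?thesis
    using assms(2) by (simp add: coeff_sum)
qed

text \<open>The maximal ideal is generated by \<open>tau\<close> modulo \<open>F\<close>, as \<open>W\<close> can be eliminated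
  using the equation \<open>F = T F1 + W F2\<close> with the unit \<open>F2\<close>.\<close>

lemma local_ring_step:
  assumes "r \<in> local_ring P"
  shows "\<exists>c r' s. r' \<in> local_ring P \<and> s \<in> local_ring P \<and> r = scalar c + tau * r' + Fhat * s"
proof -
  obtain A B n where r: "r = Fract A B" and hA: "homogeneous3 n A" and hB: "homogeneous3 n B"
    and PB: "P \<notin> V B" and B0: "B \<noteq> 0"
    using assms unfolding local_ring_eq by (rule fracsE)
  \<comment> \<open>The value of \<open>r\<close> at \<open>P\<close>; after subtracting it the
    numerator vanishes at \<open>P\<close>.\<close>
  define c where "c = poly (phi A) 0 / poly (phi B) 0"
  define A' where "A' = A - const3 c * B"
  have hA': "homogeneous3 n A'"
    unfolding A'_def by (intro homogeneous3_diff homogeneous3_const_mult hA hB)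
  have A'0: "poly (phi A') 0 = 0"
    using in_V_iff[OF hB] PB by (simp add: A'_def c_def)
  have r_eq: "r = scalar c + Fract A' B"
    unfolding r A'_def using B0 by (simp add: eq_fract algebra_simps)
  show ?thesis
  proof (cases n)
    case 0
    then obtain e where e: "A' = const3 e" using hA' form0E by metis
    have "A' = 0" using A'0 unfolding e by (simp add: const3_simps)
    then have "Fract A' B = 0"
      using B0 by (simp add: Zero_fract_def eq_fract)
    then have "r = scalar c + tau * 0 + Fhat * 0"
      using r_eq by simp
    then show ?thesis using local_ring_closed(4) by blast
  next
    case (Suc m)
    obtain e A1 A2 where A': "A' = const3 e * S ^ Suc m + T * A1 + W * A2"
      and h1: "homogeneous3 m A1" and h2: "homogeneous3 m A2"
      using hA' unfolding Suc by (rule form_SucE)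
    have "e = 0" using A'0 by (simp add: A' pullS pullT pullW poly_monom)
    then have A': "A' = T * A1 + W * A2" using A' by (simp add: const3_simps)
    \<comment> \<open>Multiply T A1 + W A2 by the unit \<open>F2\<close> and replace W F2 by F - T
      F1: what remains is T G + F A2.\<close>
    define G where "G = A1 * F2 - F1 * A2"
    have hG: "homogeneous3 (m + d) G"
      unfolding G_def using homogeneous3_mult[OF h1 homF2] homogeneous3_mult[OF homF1 h2]
      by (simp add: homogeneous3_diff add.commute)
    have hBF: "homogeneous3 (n + d) (B * F2)" "P \<notin> V (B * F2)" "B * F2 \<noteq> 0"
      using homogeneous3_mult[OF hB homF2] V_mult_iff[OF hB homF2] PB smooth B0 by auto
    have "A' * F2 = T * G + F * A2"
      unfolding A' G_def F_eq by (simp add: algebra_simps)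
    then have "Fract A' B = Fract (T * G + F * A2) (B * F2)"
      using hBF(3) B0 by (simp add: eq_fract mult_ac)
    also have "\<dots> = tau * Fract (S * G) (B * F2) + Fhat * Fract (S ^ Suc d * A2) (B * F2)"
    proof -
      have "tau * Fract (S * G) (B * F2) = Fract (T * G) (B * F2)"
        using hBF(3) S_nonzero by (simp add: tau_def eq_fract mult_ac)
      moreover have "Fhat * Fract (S ^ Suc d * A2) (B * F2) = Fract (F * A2) (B * F2)"
        unfolding Fhat_def mult_fract using hBF(3) S_nonzero
        by (subst eq_fract) (auto simp: mult_ac simp del: power_Suc)
      moreover have "Fract (T * G) (B * F2) + Fract (F * A2) (B * F2) = Fract (T * G + F * A2) (B * F2)"
        using hBF(3) by (subst add_fract) (auto simp: eq_fract algebra_simps)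
      ultimately show ?thesis by simp
    qed
    finally have "r = scalar c + tau * Fract (S * G) (B * F2) + Fhat * Fract (S ^ Suc d * A2) (B * F2)"
      using r_eq by (simp add: add.assoc)
    moreover have "Fract (S * G) (B * F2) \<in> local_ring P"
      unfolding local_ring_eq using homogeneous3_mult[OF homS hG] hBF
      by (intro fracsI[of "n + d"]) (simp_all add: Suc)
    moreover have "Fract (S ^ Suc d * A2) (B * F2) \<in> local_ring P"
      unfolding local_ring_eq using homogeneous3_mult[OF homS_power h2, of "Suc d"] hBF
      by (intro fracsI[of "n + d"]) (simp_all add: Suc add.commute)
    ultimately show ?thesis by blast
  qed
qed

text \<open>A Taylor expansion modulo the curve, obtained by applying \<open>local_ring_step\<close>
  again to the cofactor of \<open>tau ^ j\<close>.\<close>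

lemma local_ring_expansion:
  assumes "r \<in> local_ring P"
  shows "\<exists>c r' s. r' \<in> local_ring P \<and> s \<in> local_ring P \<and>
    r = (\<Sum>i<j. scalar (c i) * tau ^ i) + tau ^ j * r' + Fhat * s"
proof (induction j)
  case 0
  show ?case
    using assms local_ring_closed(4) by (intro exI[of _ "\<lambda>_. 0"] exI[of _ r] exI[of _ 0]) simp
next
  case (Suc j)
  then obtain c r' s where 1: "r' \<in> local_ring P" "s \<in> local_ring P"
    "r = (\<Sum>i<j. scalar (c i) * tau ^ i) + tau ^ j * r' + Fhat * s" by blast
  obtain e r'' s' where 2: "r'' \<in> local_ring P" "s' \<in> local_ring P"
    "r' = scalar e + tau * r'' + Fhat * s'"
    using local_ring_step[OF 1(1)] by blast
  define c' where "c' = c(j := e)"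
  have "(\<Sum>i<j. scalar (c' i) * tau ^ i) = (\<Sum>i<j. scalar (c i) * tau ^ i)"
    by (rule sum.cong) (auto simp: c'_def)
  then have "r = (\<Sum>i<Suc j. scalar (c' i) * tau ^ i) + tau ^ Suc j * r'' + Fhat * (s + tau ^ j * s')"
    unfolding 1(3) 2(3) by (simp add: algebra_simps c'_def)
  moreover have "s + tau ^ j * s' \<in> local_ring P"
    using 1 2 by (intro local_ring_closed tau_power_in)
  ultimately show ?case using 2(1) by blast
qed

text \<open>If both equations vanish to order \<open>m\<close> along the arc, so does every element
  of the sum of their ideals. Hence 1, tau, ..., tau^(m-1) stay independent in the quotient.\<close>

lemma intersection_mult_ge:
  assumes "monom 1 m dvd phi A" "m \<le> N"
  shows "enat m \<le> intersection_mult A F P"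
proof -
  let ?I = "{a + b | a b. a \<in> local_ideal P A \<and> b \<in> local_ideal P F}"
  have sub: "local_ideal P B \<subseteq> fracs P (ord_ideal m)" if "monom 1 m dvd phi B" for B
  proof -
    have "{C. B dvd C} \<subseteq> ord_ideal m"
      using that by (auto simp: ord_ideal_def dvd_def)
    then show ?thesis
      unfolding local_ideal_eq by (rule fracs_mono)
  qed
  have "monom 1 m dvd phi F"
    using dvd_trans[OF monom_dvd_monom[OF assms(2)] pullF] .
  with assms(1) have "?I \<subseteq> fracs P (ord_ideal m)"
    using fracs_add[OF ideal3_ord_ideal] sub by blast
  then have "indep_mod ?I m (\<lambda>i. tau ^ i)"
    unfolding indep_mod_def using tau_independent by blast
  then show ?thesis
    unfolding intersection_mult_def using tau_power_in
    by (intro Sup_upper) auto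
qed

text \<open>By contraposition. If the pullback of \<open>A\<close> has exact order k < m, then
  \<open>A\<close> is a unit times tau^k modulo the curve. So tau^k lies in the ideal, the quotient
  is spanned by 1, ..., tau^(k-1), and the multiplicity is at most k.\<close>

lemma monom_dvd_if_intersection_mult_ge:
  assumes "homogeneous3 n A" "enat m \<le> intersection_mult A F P" "m \<le> N"
  shows "monom 1 m dvd phi A"
proof (rule ccontr)
  assume not_dvd: "\<not> monom 1 m dvd phi A"
  define k where "k = (LEAST i. coeff (phi A) i \<noteq> 0)"
  obtain i where i: "i < m" "coeff (phi A) i \<noteq> 0"
    using not_dvd by (auto simp: monom_1_dvd_iff')
  have k: "coeff (phi A) k \<noteq> 0"
    unfolding k_def using i(2) by (rule LeastI)
  have "k < m"
    using Least_le[of "\<lambda>i. coeff (phi A) i \<noteq> 0", OF i(2)] i(1) unfolding k_def by simp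
  have "coeff (phi A) i = 0" if "i < k" for i
    using not_less_Least[OF that[unfolded k_def]] by simp
  then have dvd_k: "monom 1 k dvd phi A"
    by (simp add: monom_1_dvd_iff')
  have not_dvd_k: "\<not> monom 1 (Suc k) dvd phi A"
    using k by (auto simp: monom_1_dvd_iff')
  define Ahat where "Ahat = Fract A (S ^ n)"
  have Ahat: "Ahat \<in> fracs P (ord_ideal k)"
    unfolding Ahat_def using dvd_k
    by (intro fracsI[OF assms(1) homS_power S_power_not_in_V]) (simp add: ord_ideal_def)
  then have "Ahat \<in> local_ring P"
    unfolding local_ring_eq by (auto simp: fracs_def)
  then obtain c u s where us: "u \<in> local_ring P" "s \<in> local_ring P"
    "Ahat = (\<Sum>i<k. scalar (c i) * tau ^ i) + tau ^ k * u + Fhat * s"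
    using local_ring_expansion by blast
  have Fs: "Fhat * s \<in> fracs P (ord_ideal j)" if "j \<le> N" for j
    using fracs_mult[OF ideal3_ord_ideal us(2) Fhat_ord[OF that]] by (simp add: mult.commute)
  have tu: "tau ^ k * u \<in> fracs P (ord_ideal k)"
    using fracs_mult[OF ideal3_ord_ideal us(1) tau_power_ord] by (simp add: mult.commute)
  have "(\<Sum>i<k. scalar (c i) * tau ^ i) = Ahat + (- (tau ^ k * u) + - (Fhat * s))"
    unfolding us(3) by simp
  also have "\<dots> \<in> fracs P (ord_ideal k)"
    using Ahat tu Fs[of k] \<open>k < m\<close> assms(3)
    by (intro fracs_add fracs_uminus ideal3_ord_ideal) auto
  finally have "c i = 0" if "i < k" for i
    using tau_independent that by blast
  then have Ahat_eq: "Ahat = tau ^ k * u + Fhat * s"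
    unfolding us(3) by (simp add: scalar_simps)
  obtain C D l where CD: "u = Fract C D" "homogeneous3 l C" "homogeneous3 l D" "P \<notin> V D" "D \<noteq> 0"
    using us(1) unfolding local_ring_eq by (rule fracsE)
  \<comment> \<open>The cofactor \<open>u\<close> is a unit. Otherwise tau^k u would have order at
    least k + 1; so would Fhat s, as k + 1 \<le> m \<le> N, and hence \<open>Ahat\<close>, against
    the choice of \<open>k\<close>.\<close>
  have "P \<notin> V C"
  proof
    assume "P \<in> V C"
    then have "coeff (phi C) 0 = 0"
      using in_V_iff[OF CD(2)] by (simp add: poly_0_coeff_0)
    then have "monom 1 1 dvd phi C"
      by (simp add: monom_1_dvd_iff')
    then have "monom 1 k * monom 1 1 dvd monom 1 k * phi C"
      by (rule mult_dvd_mono[OF dvd_refl])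
    then have "monom 1 (Suc k) dvd phi (T ^ k * C)"
      by (simp add: pullT monom_power mult_monom)
    moreover have "tau ^ k * u = Fract (T ^ k * C) (S ^ k * D)"
      by (simp add: CD(1) tau_power)
    moreover have "homogeneous3 (k + l) (T ^ k * C)" "homogeneous3 (k + l) (S ^ k * D)"
      using homogeneous3_mult[OF _ CD(2)] homogeneous3_mult[OF homS_power CD(3)]
        homogeneous3_power[OF homT, of k] by simp_all
    moreover have "P \<notin> V (S ^ k * D)"
      using V_mult_iff[OF homS_power CD(3)] S_power_not_in_V CD(4) by simp
    ultimately have "tau ^ k * u \<in> fracs P (ord_ideal (Suc k))"
      by (auto simp: ord_ideal_def intro!: fracsI)
    then have "Ahat \<in> fracs P (ord_ideal (Suc k))"
      unfolding Ahat_eq using Fs[of "Suc k"] \<open>k < m\<close> assms(3) fracs_add[OF ideal3_ord_ideal] by simp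
    then show False
      using dvd_if_in_ord_fracs[OF homS_power S_power_not_in_V] not_dvd_k unfolding Ahat_def by blast
  qed
  then have v: "Fract D C \<in> local_ring P"
    unfolding local_ring_eq using CD by (auto intro: fracsI)
  have "C \<noteq> 0" using \<open>P \<notin> V C\<close> by auto
  then have uv: "Fract D C * u = 1"
    using CD by (simp add: One_fract_def eq_fract mult.commute)
  let ?I = "{a + b | a b. a \<in> local_ideal P A \<and> b \<in> local_ideal P F}"
  have "Ahat \<in> local_ideal P A"
    unfolding Ahat_def local_ideal_eq by (intro fracsI[OF assms(1) homS_power S_power_not_in_V]) simp
  then have ideal_A: "b * Ahat \<in> local_ideal P A" if "b \<in> local_ring P" for b
    using that fracs_mult[OF ideal3_dvd] unfolding local_ideal_eq by blast
  have "Fhat \<in> local_ideal P F"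
    unfolding Fhat_def local_ideal_eq by (intro fracsI[OF homF homS_power S_power_not_in_V]) simp
  then have ideal_F: "b * Fhat \<in> local_ideal P F" if "b \<in> local_ring P" for b
    using that fracs_mult[OF ideal3_dvd] unfolding local_ideal_eq by blast
  \<comment> \<open>Expand each of the \<open>n'\<close> elements up to tau^k. If n' > k, some
    nontrivial combination kills the \<open>k\<close> leading coefficients, and the rest is a
    combination of tau^k and Fhat, which lies in the ideal.\<close>
  have bound: "n' \<le> k" if r: "\<forall>i<n'. r i \<in> local_ring P" and indep: "indep_mod ?I n' r" for n' r
  proof (rule ccontr)
    assume "\<not> n' \<le> k"
    then have "k < card {..<n'}" by simp
    have "\<forall>i. \<exists>c r' s. i < n' \<longrightarrow> r' \<in> local_ring P \<and> s \<in> local_ring P \<and>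
        r i = (\<Sum>l<k. scalar (c l) * tau ^ l) + tau ^ k * r' + Fhat * s"
      using r local_ring_expansion by blast
    from choice[OF this] obtain c where "\<forall>i. \<exists>r' s. i < n' \<longrightarrow> r' \<in> local_ring P \<and> s \<in> local_ring P \<and>
        r i = (\<Sum>l<k. scalar (c i l) * tau ^ l) + tau ^ k * r' + Fhat * s" ..
    from choice[OF this] obtain r' where "\<forall>i. \<exists>s. i < n' \<longrightarrow> r' i \<in> local_ring P \<and> s \<in> local_ring P \<and>
        r i = (\<Sum>l<k. scalar (c i l) * tau ^ l) + tau ^ k * r' i + Fhat * s" ..
    from choice[OF this] obtain s' where e: "\<forall>i. i < n' \<longrightarrow> r' i \<in> local_ring P \<and> s' i \<in> local_ring P \<and>
        r i = (\<Sum>l<k. scalar (c i l) * tau ^ l) + tau ^ k * r' i + Fhat * s' i" ..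
    obtain a where a: "\<exists>i\<in>{..<n'}. a i \<noteq> 0" "\<forall>l<k. (\<Sum>i<n'. a i * c i l) = 0"
      using more_vectors_than_dimension[OF finite_lessThan \<open>k < card {..<n'}\<close>] by blast
    define R where "R = (\<Sum>i<n'. scalar (a i) * r' i)"
    define Q where "Q = (\<Sum>i<n'. scalar (a i) * s' i)"
    have RQ: "R \<in> local_ring P" "Q \<in> local_ring P"
      unfolding R_def Q_def by (rule local_ring_sum, rule local_ring_closed(2)[OF scalar_in_local_ring], use e in simp)+
    have "(\<Sum>i<n'. scalar (a i) * (\<Sum>l<k. scalar (c i l) * tau ^ l)) =
        (\<Sum>l<k. (\<Sum>i<n'. scalar (a i * c i l)) * tau ^ l)"
      unfolding sum_distrib_left sum_distrib_right scalar_simps(2)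
      by (subst sum.swap) (simp only: mult.assoc)
    also have "\<dots> = 0"
    proof (intro sum.neutral ballI)
      fix l assume "l \<in> {..<k}"
      then show "(\<Sum>i<n'. scalar (a i * c i l)) * tau ^ l = 0"
        using a(2) by (simp only: scalar_sum[symmetric] lessThan_iff scalar_simps(3) mult_zero_left)
    qed
    finally have "(\<Sum>i<n'. scalar (a i) * r i) = tau ^ k * R + Fhat * Q"
      unfolding R_def Q_def by (simp add: e distrib_left sum.distrib sum_distrib_left mult_ac)
    \<comment> \<open>Solves Ahat = tau^k u + Fhat s for tau^k, using that \<open>Fract D C\<close>
      is the inverse of \<open>u\<close>.\<close>
    also have "tau ^ k = Fract D C * Ahat - Fract D C * s * Fhat"
    proof -
      have "Fract D C * Ahat = (Fract D C * u) * tau ^ k + Fract D C * s * Fhat"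
        unfolding Ahat_eq by (simp only: distrib_left mult_ac)
      then show ?thesis unfolding uv by (simp add: algebra_simps)
    qed
    also have "(Fract D C * Ahat - Fract D C * s * Fhat) * R + Fhat * Q =
        (R * Fract D C) * Ahat + (Q + - (R * (Fract D C * s))) * Fhat"
      by (simp add: algebra_simps)
    also have "\<dots> \<in> ?I"
    proof -
      have "(R * Fract D C) * Ahat \<in> local_ideal P A"
        by (intro ideal_A local_ring_closed RQ v)
      moreover have "(Q + - (R * (Fract D C * s))) * Fhat \<in> local_ideal P F"
        by (intro ideal_F local_ring_closed RQ v us)
      ultimately show ?thesis by blast
    qed
    finally have "\<forall>i<n'. a i = 0"
      using indep unfolding indep_mod_def by blast
    then show False using a(1) by auto
  qed
  have "intersection_mult A F P \<le> enat k"
    unfolding intersection_mult_def using bound by (intro Sup_least) auto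
  then have "enat m \<le> enat k" using assms(2) order_trans by blast
  then show False using \<open>k < m\<close> by simp
qed

theorem intersection_mult_ge_iff:
  "homogeneous3 n A \<Longrightarrow> m \<le> N \<Longrightarrow> enat m \<le> intersection_mult A F P \<longleftrightarrow> monom 1 m dvd phi A"
  using intersection_mult_ge monom_dvd_if_intersection_mult_ge by blast

end

section \<open>The Fermat curve\<close>

text \<open>The binomial expansion modulo p^6, by Pascal's rule. The coefficients are written as
  polynomials in d, so that field arithmetic can treat all d at once.\<close>

lemma one_plus_power_expansion:
  fixes p :: "complex poly"
  shows "\<exists>R. (1 + p) ^ d = 1 + [:of_nat d:] * p + [:of_nat d * (of_nat d - 1) / 2:] * p ^ 2
    + [:of_nat d * (of_nat d - 1) * (of_nat d - 2) / 6:] * p ^ 3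
    + [:of_nat d * (of_nat d - 1) * (of_nat d - 2) * (of_nat d - 3) / 24:] * p ^ 4
    + [:of_nat d * (of_nat d - 1) * (of_nat d - 2) * (of_nat d - 3) * (of_nat d - 4) / 120:] * p ^ 5
    + p ^ 6 * R"
proof (induction d)
  case 0
  show ?case by (rule exI[of _ 0]) simp
next
  case (Suc d)
  define D :: complex where "D = of_nat d"
  let ?c2 = "D * (D - 1) / 2" and ?c3 = "D * (D - 1) * (D - 2) / 6"
  let ?c4 = "D * (D - 1) * (D - 2) * (D - 3) / 24"
  let ?c5 = "D * (D - 1) * (D - 2) * (D - 3) * (D - 4) / 120"
  obtain R where R: "(1 + p) ^ d = 1 + [:D:] * p + [:?c2:] * p ^ 2 + [:?c3:] * p ^ 3
      + [:?c4:] * p ^ 4 + [:?c5:] * p ^ 5 + p ^ 6 * R"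
    using Suc by (auto simp: D_def)
  have "(1 + p) ^ Suc d = 1 + ([:D:] + 1) * p + ([:?c2:] + [:D:]) * p ^ 2 + ([:?c3:] + [:?c2:]) * p ^ 3
      + ([:?c4:] + [:?c3:]) * p ^ 4 + ([:?c5:] + [:?c4:]) * p ^ 5 + p ^ 6 * (R + p * R + [:?c5:])"
  proof -
    have "(1 + p) * (1 + k1 * p + k2 * p ^ 2 + k3 * p ^ 3 + k4 * p ^ 4 + k5 * p ^ 5 + p ^ 6 * R) =
      1 + (k1 + 1) * p + (k2 + k1) * p ^ 2 + (k3 + k2) * p ^ 3
      + (k4 + k3) * p ^ 4 + (k5 + k4) * p ^ 5 + p ^ 6 * (R + p * R + k5)" for k1 k2 k3 k4 k5
      by algebra
    then show ?thesis unfolding power_Suc R .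
  qed
  also have "[:D:] + 1 = [:D + 1:]" by (simp add: one_pCons)
  also have "[:?c2:] + [:D:] = [:(D + 1) * (D + 1 - 1) / 2:]"
    by (simp add: field_simps)
  also have "[:?c3:] + [:?c2:] = [:(D + 1) * (D + 1 - 1) * (D + 1 - 2) / 6:]"
    by (simp add: field_simps)
  also have "[:?c4:] + [:?c3:] = [:(D + 1) * (D + 1 - 1) * (D + 1 - 2) * (D + 1 - 3) / 24:]"
    by (simp add: field_simps)
  also have "[:?c5:] + [:?c4:] = [:(D + 1) * (D + 1 - 1) * (D + 1 - 2) * (D + 1 - 3) * (D + 1 - 4) / 120:]"
    by (simp add: field_simps)
  finally show ?case unfolding D_def by (auto simp: add.commute)
qed

text \<open>Coefficients of the expansion \<open>1 + a t^2 + b t^4\<close> of \<open>(((1+t)^d + (1-t)^d) / 2)^(1/d)\<close>,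
  with \<open>b = - k a^2\<close>.\<close>

definition arc_a :: "nat \<Rightarrow> complex" where
  "arc_a d = (of_nat d - 1) / 2"

definition arc_k :: "nat \<Rightarrow> complex" where
  "arc_k d = (2 * of_nat d - 3) * (of_nat d + 1) / (6 * (of_nat d - 1))"

definition arc_b :: "nat \<Rightarrow> complex" where
  "arc_b d = - arc_k d * arc_a d ^ 2"

lemma arc_a_nonzero: "d \<ge> 3 \<Longrightarrow> arc_a d \<noteq> 0"
  by (auto simp: arc_a_def)

lemma arc_k_nonzero:
  assumes "d \<ge> 3"
  shows "arc_k d \<noteq> 0"
proof -
  have "2 * of_nat d - 3 = (of_nat (2 * d - 3) :: complex)"
    using assms by (simp add: of_nat_diff)
  moreover have "of_nat d + 1 \<noteq> (0 :: complex)"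
    using of_nat_neq_0[of d] by (simp add: add.commute)
  moreover have "of_nat d - 1 = (of_nat (d - 1) :: complex)"
    using assms by (simp add: of_nat_diff)
  ultimately show ?thesis
    using assms unfolding arc_k_def by (simp del: of_nat_mult of_nat_add of_nat_diff)
qed

text \<open>Clearing the denominator, (2d - 3)(d + 1) - 6(d - 1) factors as (2d - 1)(d - 3). This is
  what separates the case d = 3.\<close>

lemma arc_k_eq_1_iff:
  assumes "d \<ge> 3"
  shows "arc_k d = 1 \<longleftrightarrow> d = 3"
proof -
  define D :: complex where "D = of_nat d"
  have D1: "D - 1 \<noteq> 0" using assms by (auto simp: D_def)
  have "2 * D - 1 = of_nat (2 * d - 1)"
    using assms by (simp add: D_def of_nat_diff)
  then have D2: "2 * D - 1 \<noteq> 0" using assms by (simp del: of_nat_diff)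
  have "arc_k d = 1 \<longleftrightarrow> (2 * D - 3) * (D + 1) = 6 * (D - 1)"
    using D1 by (simp add: arc_k_def D_def[symmetric])
  also have "\<dots> \<longleftrightarrow> (2 * D - 1) * (D - 3) = 0"
    by (simp add: algebra_simps)
  also have "\<dots> \<longleftrightarrow> D = 3" using D2 by simp
  also have "\<dots> \<longleftrightarrow> d = 3" unfolding D_def
    by (metis of_nat_eq_iff of_nat_numeral)
  finally show ?thesis .
qed

text \<open>The constant terms and the odd powers of t cancel. The coefficient of t^2 vanishes
  because c2 = d a, and that of t^4 because c4 = d b + c2 a^2; these two equations determine a and
  b.\<close>

lemma arc_identity:
  assumes "d \<ge> 3"
  shows "monom 1 6 dvd [:1, 1:] ^ d + [:1, -1:] ^ d - 2 * [:1, 0, arc_a d, 0, arc_b d:] ^ d"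
proof -
  define D :: complex where "D = of_nat d"
  have D1: "D - 1 \<noteq> 0" using assms by (auto simp: D_def)
  define a b where "a = arc_a d" and "b = arc_b d"
  define c2 where "c2 = D * (D - 1) / 2"
  define c3 where "c3 = D * (D - 1) * (D - 2) / 6"
  define c4 where "c4 = D * (D - 1) * (D - 2) * (D - 3) / 24"
  define c5 where "c5 = D * (D - 1) * (D - 2) * (D - 3) * (D - 4) / 120"
  define t where "t = [:0, 1 :: complex:]"
  define v where "v = [:a:] + [:b:] * t ^ 2"
  have expand: "\<exists>R. (1 + p) ^ d = 1 + [:D:] * p + [:c2:] * p ^ 2 + [:c3:] * p ^ 3
      + [:c4:] * p ^ 4 + [:c5:] * p ^ 5 + p ^ 6 * R" for p
    unfolding c2_def c3_def c4_def c5_def D_def by (rule one_plus_power_expansion)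
  obtain R1 where R1: "(1 + t) ^ d = 1 + [:D:] * t + [:c2:] * t ^ 2 + [:c3:] * t ^ 3
      + [:c4:] * t ^ 4 + [:c5:] * t ^ 5 + t ^ 6 * R1" using expand by blast
  obtain R2 where R2: "(1 + - t) ^ d = 1 + [:D:] * (- t) + [:c2:] * (- t) ^ 2 + [:c3:] * (- t) ^ 3
      + [:c4:] * (- t) ^ 4 + [:c5:] * (- t) ^ 5 + (- t) ^ 6 * R2" using expand by blast
  obtain R3 where R3: "(1 + t ^ 2 * v) ^ d = 1 + [:D:] * (t ^ 2 * v) + [:c2:] * (t ^ 2 * v) ^ 2
      + [:c3:] * (t ^ 2 * v) ^ 3 + [:c4:] * (t ^ 2 * v) ^ 4 + [:c5:] * (t ^ 2 * v) ^ 5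
      + (t ^ 2 * v) ^ 6 * R3" using expand by blast
  \<comment> \<open>Collects the terms from the third power of t^2 v onwards, all of which are
    divisible by t^6.\<close>
  define M where "M = [:c3:] * v ^ 3 + [:c4:] * (t ^ 2 * v ^ 4) + [:c5:] * (t ^ 4 * v ^ 5) + t ^ 6 * v ^ 6 * R3"
  have R3': "(1 + t ^ 2 * v) ^ d = 1 + [:D:] * (t ^ 2 * ([:a:] + [:b:] * t ^ 2))
      + [:c2:] * (t ^ 4 * ([:a:] ^ 2 + 2 * [:a:] * [:b:] * t ^ 2 + [:b:] ^ 2 * t ^ 4)) + t ^ 6 * M"
  proof -
    have "(t ^ 2 * v) ^ 2 = t ^ 4 * v ^ 2" "(t ^ 2 * v) ^ 3 = t ^ 6 * v ^ 3"
      "(t ^ 2 * v) ^ 4 = t ^ 6 * (t ^ 2 * v ^ 4)" "(t ^ 2 * v) ^ 5 = t ^ 6 * (t ^ 4 * v ^ 5)"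
      "(t ^ 2 * v) ^ 6 = t ^ 6 * (t ^ 6 * v ^ 6)"
      by (simp_all add: power_mult_distrib power_mult[symmetric] mult.assoc[symmetric] power_add[symmetric])
    note powers = this
    have "([:b:] * t ^ 2) ^ 2 = [:b:] ^ 2 * t ^ 4"
      by (simp only: power_mult_distrib power_mult[symmetric]) simp
    then have v2: "v ^ 2 = [:a:] ^ 2 + 2 * [:a:] * [:b:] * t ^ 2 + [:b:] ^ 2 * t ^ 4"
      unfolding v_def power2_sum by (simp only: mult.assoc add_ac)
    have "x3 * (y * z3) + x4 * (y * z4) + x5 * (y * z5) + y * z6 * R3 = y * (x3 * z3 + x4 * z4 + x5 * z5 + z6 * R3)"
      for x3 x4 x5 y z3 z4 z5 z6 :: "complex poly"
      by (simp add: algebra_simps)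
    then show ?thesis
      unfolding R3 powers v2[symmetric] M_def v_def[symmetric] by (simp only: add.assoc)
  qed
  \<comment> \<open>Stated for arbitrary polynomials, this is a pure ring identity; the special
    values of the coefficients enter only afterwards.\<close>
  have regroup: "(1 + D' * u + k2 * u ^ 2 + k3 * u ^ 3 + k4 * u ^ 4 + k5 * u ^ 5 + u ^ 6 * r1)
      + (1 + D' * (- u) + k2 * (- u) ^ 2 + k3 * (- u) ^ 3 + k4 * (- u) ^ 4 + k5 * (- u) ^ 5 + (- u) ^ 6 * r2)
      - 2 * (1 + D' * (u ^ 2 * (a' + b' * u ^ 2)) + k2 * (u ^ 4 * (a' ^ 2 + 2 * a' * b' * u ^ 2 + b' ^ 2 * u ^ 4)) + u ^ 6 * m)
    = 2 * (k2 - D' * a') * u ^ 2 + 2 * (k4 - D' * b' - k2 * a' ^ 2) * u ^ 4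
      + u ^ 6 * (r1 + r2 - 2 * k2 * (2 * a' * b' + b' ^ 2 * u ^ 2) - 2 * m)"
    for D' a' b' u k2 k3 k4 k5 r1 r2 m :: "complex poly"
    by algebra
  have "[:1, 1:] ^ d + [:1, -1:] ^ d - 2 * [:1, 0, a, 0, b:] ^ d =
      (1 + t) ^ d + (1 + - t) ^ d - 2 * (1 + t ^ 2 * v) ^ d"
    by (simp add: t_def v_def one_pCons power2_eq_square)
  also have "\<dots> = 2 * ([:c2:] - [:D:] * [:a:]) * t ^ 2 + 2 * ([:c4:] - [:D:] * [:b:] - [:c2:] * [:a:] ^ 2) * t ^ 4
      + t ^ 6 * (R1 + R2 - 2 * [:c2:] * (2 * [:a:] * [:b:] + [:b:] ^ 2 * t ^ 2) - 2 * M)"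
    unfolding R1 R2 R3' by (rule regroup)
  also have "[:c2:] - [:D:] * [:a:] = 0"
    by (simp add: c2_def a_def arc_a_def D_def)
  also have "[:c4:] - [:D:] * [:b:] - [:c2:] * [:a:] ^ 2 = 0"
  proof -
    have "c4 - D * b - c2 * a ^ 2 = 0"
      using D1 unfolding c4_def c2_def a_def b_def arc_b_def arc_a_def arc_k_def D_def[symmetric]
      by (simp add: field_simps power2_eq_square)
    then show ?thesis by (simp add: power2_eq_square mult_ac)
  qed
  finally have "[:1, 1:] ^ d + [:1, -1:] ^ d - 2 * [:1, 0, a, 0, b:] ^ d = t ^ 6 *
      (R1 + R2 - 2 * [:c2:] * (2 * [:a:] * [:b:] + [:b:] ^ 2 * t ^ 2) - 2 * M)"
    by simp
  moreover have "monom 1 6 = t ^ 6"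
    by (simp add: t_def monom_altdef)
  ultimately show ?thesis
    unfolding a_def b_def by simp
qed

section \<open>The Fermat curve in coordinates adapted to one line\<close>

text \<open>Intended for the variables in some order, one of them scaled by a d-th root of unity;
  the line to be studied is X = Y. Assumption \<open>surj\<close> lets arcs, and with constant
  polynomials also points, be prescribed freely in these coordinates.\<close>

locale fermat_frame = frame X Y Z for X Y Z :: poly3 +
  fixes d :: nat
  assumes d: "d \<ge> 3"
    and surj: "\<exists>x y z. pull x y z X = p \<and> pull x y z Y = q \<and> pull x y z Z = r"
    and fermat_eq: "fermat d = X ^ d + Y ^ d + Z ^ d"
begin

text \<open>Exchanging X and Y fixes \<open>S\<close> and Z and negates \<open>T\<close>. The line
  becomes T = 0, and for w^d = -2 the form \<open>W w\<close> is the tangent at the point with S =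
  1, T = 0, Z = w.\<close>

definition S :: poly3 where "S = const3 (1 / 2) * (X + Y)"
definition T :: poly3 where "T = const3 (1 / 2) * (X - Y)"
definition W :: "complex \<Rightarrow> poly3" where "W w = const3 (1 / w) * Z - S"

definition conic :: "complex \<Rightarrow> poly3" where
  "conic w = S * W w - const3 (arc_a d) * T ^ 2 + const3 (arc_k d) * W w ^ 2"

text \<open>Coordinates with respect to \<open>S\<close>, \<open>T\<close>, \<open>Z\<close> do not
  involve w, so the conics belonging to different points can be compared at one point of the
  plane.\<close>

definition located :: "proj_plane \<Rightarrow> complex \<Rightarrow> complex \<Rightarrow> complex \<Rightarrow> bool" where
  "located P s t u \<longleftrightarrow> (\<exists>x y z. has_coords P x y z \<and> eval3 S x y z = s \<and> eval3 T x y z = t \<and> eval3 Z x y z = u)"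

lemma hom_ST [intro]: "homogeneous3 (Suc 0) S" "homogeneous3 (Suc 0) T" "homogeneous3 (Suc 0) (W w)"
  unfolding W_def S_def T_def
  by (intro homogeneous3_const_mult homogeneous3_add homogeneous3_diff homS homT homW)+

lemma X_eq: "X = S + T" and Y_eq: "Y = S - T"
proof -
  have half: "const3 (1 / 2) + const3 (1 / 2) = 1"
    by (simp flip: const3_simps)
  have "S + T = (const3 (1 / 2) + const3 (1 / 2)) * X" "S - T = (const3 (1 / 2) + const3 (1 / 2)) * Y"
    unfolding S_def T_def by (simp_all add: algebra_simps)
  then show "X = S + T" "Y = S - T"
    unfolding half by simp_all
qed

lemma eval3_XY:
  "eval3 X x y z = eval3 S x y z + eval3 T x y z" "eval3 Y x y z = eval3 S x y z - eval3 T x y z"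
  by (simp_all add: S_def T_def field_simps)

lemma Z_eq: "w \<noteq> 0 \<Longrightarrow> Z = const3 w * (S + W w)"
  by (simp add: W_def mult.assoc[symmetric] const3_simps(4)[symmetric] const3_simps(2))

lemma span_ST:
  assumes "w \<noteq> 0" "\<exists>a b c. v = const3 a * X + const3 b * Y + const3 c * Z"
  shows "\<exists>a b c. v = const3 a * S + const3 b * T + const3 c * W w"
proof -
  obtain a b c where "v = const3 a * X + const3 b * Y + const3 c * Z"
    using assms(2) by blast
  also have "\<dots> = const3 a * (S + T) + const3 b * (S - T) + const3 c * (const3 w * (S + W w))"
    by (simp only: X_eq[symmetric] Y_eq[symmetric] Z_eq[OF assms(1), symmetric])
  also have "\<dots> = const3 (a + b + c * w) * S + const3 (a - b) * T + const3 (c * w) * W w"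
    by (simp add: const3_simps algebra_simps)
  finally show ?thesis by blast
qed

lemma frame_ST:
  assumes "w \<noteq> 0"
  shows "frame S T (W w)"
  by (rule frame.intro[OF hom_ST span_ST[OF assms spanx] span_ST[OF assms spany] span_ST[OF assms spanz]])

text \<open>The forms \<open>S\<close>, \<open>T\<close>, \<open>Z\<close> determine X and Y, and
  the variables are linear combinations of X, Y, Z.\<close>

lemma coords_determined:
  assumes "eval3 S x y z = eval3 S x' y' z'" "eval3 T x y z = eval3 T x' y' z'"
    "eval3 Z x y z = eval3 Z x' y' z'"
  shows "x = x'" "y = y'" "z = z'"
proof -
  have XY: "eval3 X x y z = eval3 X x' y' z'" "eval3 Y x y z = eval3 Y x' y' z'"
    using assms by (simp_all add: eval3_XY)
  have "eval3 v x y z = eval3 v x' y' z'"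
    if v: "\<exists>a b c. v = const3 a * X + const3 b * Y + const3 c * Z" for v
    using v assms(3) XY by auto
  from this[OF spanx] this[OF spany] this[OF spanz] show "x = x'" "y = y'" "z = z'"
    by simp_all
qed

lemma eval3_linear_0: "homogeneous3 (Suc 0) A \<Longrightarrow> eval3 A 0 0 0 = 0"
  using eval3_scale[of "Suc 0" A 0 0 0 0] by simp

lemma located_surj: "\<exists>P. located P s t u" if "s \<noteq> 0"
proof -
  \<comment> \<open>A point is found as the value at 0 of an arc with constant X, Y, Z; s \<noteq> 0
    keeps its coordinates from all vanishing.\<close>
  obtain x y z where xyz: "pull x y z X = [:s + t:]" "pull x y z Y = [:s - t:]" "pull x y z Z = [:u:]"
    using surj by blast
  have X: "eval3 X (poly x 0) (poly y 0) (poly z 0) = s + t"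
    and Y: "eval3 Y (poly x 0) (poly y 0) (poly z 0) = s - t"
    and Z: "eval3 Z (poly x 0) (poly y 0) (poly z 0) = u"
    by (simp_all add: xyz flip: poly_pull)
  have S: "eval3 S (poly x 0) (poly y 0) (poly z 0) = s"
    and T: "eval3 T (poly x 0) (poly y 0) (poly z 0) = t"
    by (simp_all add: S_def T_def X Y)
  have "(poly x 0, poly y 0, poly z 0) \<noteq> (0, 0, 0)"
    using S that eval3_linear_0[OF hom_ST(1)] by force
  then have "has_coords (abs_proj_plane (poly x 0, poly y 0, poly z 0)) (poly x 0) (poly y 0) (poly z 0)"
    by (simp add: has_coords_def)
  then show ?thesis using S T Z unfolding located_def by blast
qed

lemma located_exists:
  obtains s t u where "located P s t u" "(s, t, u) \<noteq> (0, 0, 0)"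
proof -
  obtain x y z where P: "has_coords P x y z" by (rule has_coords_exists)
  have "located P (eval3 S x y z) (eval3 T x y z) (eval3 Z x y z)"
    using P unfolding located_def by blast
  moreover have "(eval3 S x y z, eval3 T x y z, eval3 Z x y z) \<noteq> (0, 0, 0)"
    using P coords_determined[of x y z 0 0 0] eval3_linear_0 hom_ST homW by (auto simp: has_coords_def)
  ultimately show ?thesis by (rule that)
qed

lemma located_scale:
  assumes "located P s t u" "c \<noteq> 0"
  shows "located P (c * s) (c * t) (c * u)"
proof -
  obtain x y z where 1: "has_coords P x y z" "eval3 S x y z = s" "eval3 T x y z = t" "eval3 Z x y z = u"
    using assms(1) by (auto simp: located_def)
  then show ?thesis
    unfolding located_def using has_coords_scale[OF 1(1) assms(2)] eval3_scale[OF hom_ST(1), of c x y z]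
      eval3_scale[OF hom_ST(2), of c x y z] eval3_scale[OF homW, of c x y z]
    by (intro exI[of _ "c * x"] exI[of _ "c * y"] exI[of _ "c * z"]) simp
qed

lemma located_unique_point:
  assumes "located P s t u" "located P' s t u"
  shows "P = P'"
proof -
  obtain x y z where 1: "has_coords P x y z" "eval3 S x y z = s" "eval3 T x y z = t" "eval3 Z x y z = u"
    using assms(1) by (auto simp: located_def)
  obtain x' y' z' where 2: "has_coords P' x' y' z'" "eval3 S x' y' z' = s" "eval3 T x' y' z' = t"
    "eval3 Z x' y' z' = u"
    using assms(2) by (auto simp: located_def)
  have "x = x'" "y = y'" "z = z'"
    using coords_determined[of x y z x' y' z'] 1 2 by simp_all
  then show ?thesis using 1(1) 2(1) by (simp add: has_coords_def)
qed

lemma located_unique_coords: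
  assumes "located P s t u" "located P s' t' u'"
  obtains c where "c \<noteq> 0" "s' = c * s" "t' = c * t" "u' = c * u"
proof -
  obtain x y z where 1: "has_coords P x y z" "eval3 S x y z = s" "eval3 T x y z = t" "eval3 Z x y z = u"
    using assms(1) by (auto simp: located_def)
  obtain x' y' z' where 2: "has_coords P x' y' z'" "eval3 S x' y' z' = s'" "eval3 T x' y' z' = t'"
    "eval3 Z x' y' z' = u'"
    using assms(2) by (auto simp: located_def)
  obtain c where "c \<noteq> 0" "x' = c * x" "y' = c * y" "z' = c * z"
    using 1(1) 2(1) by (rule has_coords_unique)
  then show ?thesis
    using that[of c] 1 2 eval3_scale[OF hom_ST(1)] eval3_scale[OF hom_ST(2)] eval3_scale[OF homW] by simp
qed

lemma homogeneous3_conic: "homogeneous3 2 (conic w)"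
proof -
  have "homogeneous3 2 (T ^ 2)" "homogeneous3 2 (W w ^ 2)" "homogeneous3 2 (S * W w)"
    using homogeneous3_power[OF hom_ST(2), of 2] homogeneous3_power[OF hom_ST(3), of 2]
      homogeneous3_mult[OF hom_ST(1) hom_ST(3)[of w]] by (simp_all add: numeral_2_eq_2)
  then show ?thesis
    unfolding conic_def by (intro homogeneous3_add homogeneous3_diff homogeneous3_const_mult)
qed

lemma homogeneous3_fermat: "homogeneous3 d (fermat d)"
  unfolding fermat_def using homogeneous3_power[OF homogeneous3_var(1), of d]
    homogeneous3_power[OF homogeneous3_var(2), of d] homogeneous3_power[OF homogeneous3_var(3), of d]
  by (auto intro: homogeneous3_add)

lemma in_V_conic_iff:
  assumes "located P s t u"
  shows "P \<in> V (conic w) \<longleftrightarrow>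
    s * (u / w - s) - arc_a d * t ^ 2 + arc_k d * (u / w - s) ^ 2 = 0"
proof -
  obtain x y z where 1: "has_coords P x y z" "eval3 S x y z = s" "eval3 T x y z = t" "eval3 Z x y z = u"
    using assms(1) by (auto simp: located_def)
  then show ?thesis
    using V_iff[OF homogeneous3_conic 1(1)] by (simp add: conic_def W_def)
qed

lemma in_V_fermat_iff:
  assumes "located P s t u"
  shows "P \<in> V (fermat d) \<longleftrightarrow> (s + t) ^ d + (s - t) ^ d + u ^ d = 0"
proof -
  obtain x y z where 1: "has_coords P x y z" "eval3 S x y z = s" "eval3 T x y z = t" "eval3 Z x y z = u"
    using assms(1) by (auto simp: located_def)
  have "fermat d = (S + T) ^ d + (S - T) ^ d + Z ^ d"
    by (simp only: fermat_eq X_eq[symmetric] Y_eq[symmetric])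
  then show ?thesis
    using V_iff[OF homogeneous3_fermat 1(1)] 1 by simp
qed

lemma conic_nonzero: "conic w \<noteq> 0"
proof
  assume "conic w = 0"
  \<comment> \<open>The point S = 0, T = 1, Z = 0, where only the term in T^2 survives.\<close>
  moreover obtain x y z where xyz: "pull x y z X = [:1:]" "pull x y z Y = [:-1:]" "pull x y z Z = [:0:]"
    using surj by blast
  have "pull x y z S = 0" "pull x y z T = 1"
    by (simp_all add: S_def T_def xyz one_pCons)
  then have "pull x y z (conic w) = [:- arc_a d:]"
    by (simp add: conic_def W_def xyz)
  ultimately show False using arc_a_nonzero[OF d] by simp
qed

text \<open>The curve is (S + T)^d + (S - T)^d - 2 (S + W)^d. Each power is S^d plus a multiple of T
  or W, and the multiples of S^d cancel. The cofactor of W takes the value -2d at the point, so the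
  curve is smooth there.\<close>

lemma smooth_arc_exists:
  assumes w: "w ^ d = -2" and P: "located P 1 0 w"
  obtains F1 F2 x y z where "smooth_arc S T (W w) (fermat d) F1 F2 P x y z (d - 1) 6"
    "pull x y z (W w) = [:0, 0, arc_a d, 0, arc_b d:]"
proof -
  have w0: "w \<noteq> 0" using w d by (auto simp: power_0_left)
  obtain x y z where xyz: "pull x y z X = [:1, 1:]" "pull x y z Y = [:1, -1:]"
      "pull x y z Z = smult w [:1, 0, arc_a d, 0, arc_b d:]"
    using surj by blast
  have pS: "pull x y z S = 1" and pT: "pull x y z T = [:0, 1:]"
    by (simp_all add: S_def T_def xyz one_pCons)
  have pW: "pull x y z (W w) = [:0, 0, arc_a d, 0, arc_b d:]"
    using w0 by (simp add: W_def pS xyz one_pCons)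
  have P': "has_coords P (poly x 0) (poly y 0) (poly z 0)"
  proof -
    have S: "eval3 S (poly x 0) (poly y 0) (poly z 0) = 1"
      and T: "eval3 T (poly x 0) (poly y 0) (poly z 0) = 0"
      and Z: "eval3 Z (poly x 0) (poly y 0) (poly z 0) = w"
      by (simp_all add: pS pT xyz flip: poly_pull)
    have "(poly x 0, poly y 0, poly z 0) \<noteq> (0, 0, 0)"
      using S eval3_linear_0[OF hom_ST(1)] by force
    then have 1: "has_coords (abs_proj_plane (poly x 0, poly y 0, poly z 0)) (poly x 0) (poly y 0) (poly z 0)"
      by (simp add: has_coords_def)
    then have "located (abs_proj_plane (poly x 0, poly y 0, poly z 0)) 1 0 w"
      using S T Z unfolding located_def by blast
    then show ?thesis using 1 located_unique_point[OF P] by simp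
  qed
  \<comment> \<open>The quotient of U^d - S^d by U - S.\<close>
  define G where "G U = (\<Sum>i<d. S ^ (d - Suc i) * U ^ i)" for U
  have G: "U ^ d = S ^ d + (U - S) * G U" for U
    using power_diff_sumr2[of U d S] by (simp add: G_def algebra_simps)
  have homG: "homogeneous3 (d - 1) (G U)" if "homogeneous3 (Suc 0) U" for U
    unfolding G_def
  proof (rule homogeneous3_sum)
    fix i assume "i \<in> {..<d}"
    then show "homogeneous3 (d - 1) (S ^ (d - Suc i) * U ^ i)"
      using homogeneous3_mult[OF homogeneous3_power[OF hom_ST(1), of "d - Suc i"] homogeneous3_power[OF that, of i]]
      by simp
  qed
  define F1 where "F1 = G (S + T) - G (S - T)"
  define F2 where "F2 = const3 (-2) * G (S + W w)"
  have hF: "homogeneous3 (d - 1) F1" "homogeneous3 (d - 1) F2"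
    unfolding F1_def F2_def
    by (intro homogeneous3_diff homogeneous3_const_mult homG homogeneous3_add hom_ST)+
  have F: "fermat d = (S + T) ^ d + (S - T) ^ d + const3 (-2) * (S + W w) ^ d"
  proof -
    have "(const3 w * (S + W w)) ^ d = const3 (-2) * (S + W w) ^ d"
      by (simp only: power_mult_distrib const3_power[symmetric] w)
    then show ?thesis
      by (simp only: fermat_eq X_eq[symmetric] Y_eq[symmetric] Z_eq[OF w0, symmetric])
  qed
  have two: "const3 (-2) = -2"
    using const3_of_nat[of 2] const3_simps(5)[of 2] by simp
  have "fermat d = T * F1 + W w * F2"
    unfolding F G[of "S + T"] G[of "S - T"] G[of "S + W w"] F1_def F2_def two
    by (simp add: algebra_simps)
  moreover have "P \<notin> V F2"
  proof -
    have "poly (pull x y z F2) 0 = -2 * of_nat d"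
      by (simp add: F2_def G_def pull_sum pS pW poly_sum)
    then show ?thesis
      using V_iff[OF hF(2) P'] d by (simp add: poly_pull)
  qed
  moreover have "monom 1 6 dvd pull x y z (fermat d)"
  proof -
    have "pull x y z (fermat d) = [:1, 1:] ^ d + [:1, -1:] ^ d - 2 * [:1, 0, arc_a d, 0, arc_b d:] ^ d"
      unfolding F by (simp add: pS pT pW one_pCons numeral_poly)
    then show ?thesis using arc_identity[OF d] by simp
  qed
  moreover have "pull x y z T = monom 1 1"
    by (simp add: pT monom_altdef)
  ultimately have "smooth_arc S T (W w) (fermat d) F1 F2 P x y z (d - 1) 6"
    by (intro smooth_arc.intro smooth_arc_axioms.intro frame_ST w0 P' pS hF) (simp_all add: pW)
  then show ?thesis using pW by (rule that)
qed

text \<open>Contact of order 5 imposes five linear conditions on the six coefficients of a conic;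
  their solutions are the multiples of \<open>conic w\<close>, and this conic has contact of order
  6.\<close>

lemma hyperosculating_conic_iff:
  assumes w: "w ^ d = -2" and P: "located P 1 0 w"
  shows "hyperosculating_conic (fermat d) P Q \<longleftrightarrow> (\<exists>c. c \<noteq> 0 \<and> Q = const3 c * conic w)"
proof -
  obtain F1 F2 x y z where sm: "smooth_arc S T (W w) (fermat d) F1 F2 P x y z (d - 1) 6"
    and pW: "pull x y z (W w) = [:0, 0, arc_a d, 0, arc_b d:]"
    using w P by (rule smooth_arc_exists)
  interpret arc: smooth_arc S T "W w" "fermat d" F1 F2 P x y z "d - 1" 6
    by (rule sm)
  note pS = arc.pullS
  have pT: "pull x y z T = [:0, 1:]"
    using arc.pullT by (simp add: monom_altdef)
  note a0 = arc_a_nonzero[OF d]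
  have "pull x y z (conic w) =
      [:0, 0, arc_a d, 0, arc_b d:] - [:arc_a d:] * [:0, 1:] ^ 2 + [:arc_k d:] * [:0, 0, arc_a d, 0, arc_b d:] ^ 2"
    by (simp add: conic_def pS pT pW)
  \<comment> \<open>The terms in t^2 cancel, and the coefficient b + k a^2 of t^4 is zero by the
    definition of \<open>arc_b\<close>.\<close>
  also have "\<dots> = monom 1 6 * [:2 * arc_k d * arc_a d * arc_b d, 0, arc_k d * arc_b d ^ 2:]"
    by (simp add: arc_b_def monom_altdef numeral_eq_Suc)
  finally have dvd6: "monom 1 6 dvd pull x y z (conic w)"
    by (simp only: dvd_triv_left)
  have mult: "homogeneous3 2 A \<Longrightarrow> enat m \<le> intersection_mult A (fermat d) P \<longleftrightarrow> monom 1 m dvd pull x y z A"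
    if "m \<le> 6" for m A
    using arc.intersection_mult_ge_iff[OF _ that] by blast
  have unique: "\<exists>c. A = const3 c * conic w" if A: "homogeneous3 2 A" "monom 1 5 dvd pull x y z A" for A
  proof -
    obtain a b c e f g where A_eq: "A = const3 a * S ^ 2 + const3 b * (S * T) + const3 c * (S * W w) +
        const3 e * T ^ 2 + const3 f * (T * W w) + const3 g * W w ^ 2"
      using A(1) by (rule arc.quadratic_formE)
    \<comment> \<open>The coefficients of t^0, ..., t^4 must vanish. As \<open>arc_a d\<close> is
      nonzero, this gives a = b = f = 0 and expresses e and g through c, the remaining free
      parameter.\<close>
    have "pull x y z A = [:a, b, c * arc_a d + e, f * arc_a d, c * arc_b d + g * arc_a d ^ 2,
        f * arc_b d, 2 * g * arc_a d * arc_b d, 0, g * arc_b d ^ 2:]"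
      unfolding A_eq by (simp add: pS pT pW power2_eq_square one_pCons algebra_simps)
    moreover have "\<forall>i<5. coeff (pull x y z A) i = 0"
      using A(2) by (simp add: monom_1_dvd_iff')
    ultimately have "a = 0" "b = 0" "c * arc_a d + e = 0" "f * arc_a d = 0"
      "c * arc_b d + g * arc_a d ^ 2 = 0"
      by (simp_all add: numeral_eq_Suc All_less_Suc)
    moreover from this have "arc_a d ^ 2 * (g - arc_k d * c) = 0"
      by (simp add: arc_b_def algebra_simps)
    ultimately have "a = 0" "b = 0" "f = 0" "e = - c * arc_a d" "g = c * arc_k d"
      using a0 by (simp_all add: eq_neg_iff_add_eq_0 add.commute mult.commute)
    then have "A = const3 c * conic w"
      unfolding A_eq conic_def by (simp add: const3_simps algebra_simps)
    then show ?thesis ..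
  qed
  show ?thesis
  proof
    assume "hyperosculating_conic (fermat d) P Q"
    then have Q: "Q \<noteq> 0" "homogeneous3 2 Q" "enat 5 \<le> intersection_mult Q (fermat d) P"
      by (auto simp: hyperosculating_conic_def osculating_conic_def is_curve_def numeral_eq_enat)
    then obtain c where c: "Q = const3 c * conic w"
      using unique mult[of 5] by auto
    moreover have "c \<noteq> 0" using c Q(1) by (auto simp: const3_simps)
    ultimately show "\<exists>c. c \<noteq> 0 \<and> Q = const3 c * conic w" by blast
  next
    assume "\<exists>c. c \<noteq> 0 \<and> Q = const3 c * conic w"
    then obtain c where c: "c \<noteq> 0" "Q = const3 c * conic w" by blast
    have hQ: "homogeneous3 2 Q" unfolding c(2) by (intro homogeneous3_const_mult homogeneous3_conic)
    have Q0: "Q \<noteq> 0" using c conic_nonzero by (simp add: const3_def)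
    have dvdQ: "monom 1 6 dvd pull x y z Q" using dvd6 by (simp add: c(2) dvd_smult)
    have ge6: "enat 6 \<le> intersection_mult Q (fermat d) P"
      using mult[OF _ hQ, of 6] dvdQ by simp
    then have ge5: "enat 5 \<le> intersection_mult Q (fermat d) P"
      by (rule order_trans[rotated]) simp
    have "same_curve Q Q'" if Q': "is_conic Q'" "enat 5 \<le> intersection_mult Q' (fermat d) P" for Q'
    proof -
      have "homogeneous3 2 Q'" "Q' \<noteq> 0" using Q' by (auto simp: is_curve_def)
      then obtain c' where c': "Q' = const3 c' * conic w"
        using unique mult[of 5] Q'(2) by auto
      have "c' \<noteq> 0" using c' \<open>Q' \<noteq> 0\<close> by (auto simp: const3_simps)
      have "const3 (c' / c) * Q = const3 (c' / c * c) * conic w"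
        unfolding c(2) const3_simps(4) by (simp only: mult.assoc)
      then have "Q' = const3 (c' / c) * Q" using c(1) c' by simp
      then show ?thesis unfolding same_curve_def using c(1) \<open>c' \<noteq> 0\<close> by (intro exI[of _ "c' / c"]) simp
    qed
    then show "hyperosculating_conic (fermat d) P Q"
      using ge5 ge6 hQ Q0
      by (auto simp: hyperosculating_conic_def osculating_conic_def is_curve_def numeral_eq_enat)
  qed
qed

section \<open>Sextactic points on the line\<close>

text \<open>A linear form a' S + b' T + c' W pulls back to a' + b' t + c' a t^2 + ..., so contact of
  order 3 makes it zero. The tangent line enters only as a nonzero linear form.\<close>

lemma not_inflection_point:
  assumes w: "w ^ d = -2" and P: "located P 1 0 w"
  shows "\<not> inflection_point (fermat d) P"
proof
  assume "inflection_point (fermat d) P"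
  then obtain a b c where L: "tangent_line (fermat d) a b c \<noteq> 0"
      "3 \<le> intersection_mult (tangent_line (fermat d) a b c) (fermat d) P"
    by (auto simp: inflection_point_def)
  obtain F1 F2 x y z where sm: "smooth_arc S T (W w) (fermat d) F1 F2 P x y z (d - 1) 6"
    and pW: "pull x y z (W w) = [:0, 0, arc_a d, 0, arc_b d:]"
    using w P by (rule smooth_arc_exists)
  interpret arc: smooth_arc S T "W w" "fermat d" F1 F2 P x y z "d - 1" 6
    by (rule sm)
  have pT: "pull x y z T = [:0, 1:]"
    using arc.pullT by (simp add: monom_altdef)
  have hL: "homogeneous3 (Suc 0) (tangent_line (fermat d) a b c)"
    unfolding tangent_line_def by (intro homogeneous3_add homogeneous3_const_mult homogeneous3_var)
  obtain a' b' c' where eq: "tangent_line (fermat d) a b c = const3 a' * S + const3 b' * T + const3 c' * W w"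
    using hL by (rule arc.linear_formE)
  have "monom 1 3 dvd pull x y z (tangent_line (fermat d) a b c)"
    using arc.intersection_mult_ge_iff[OF hL, of 3] L(2) by (simp add: numeral_eq_enat)
  moreover have "pull x y z (tangent_line (fermat d) a b c) = [:a', b', c' * arc_a d, 0, c' * arc_b d:]"
    unfolding eq by (simp add: arc.pullS pT pW one_pCons)
  ultimately have "a' = 0" "b' = 0" "c' * arc_a d = 0"
    by (simp_all add: monom_1_dvd_iff' numeral_eq_Suc All_less_Suc)
  then have "tangent_line (fermat d) a b c = 0"
    using arc_a_nonzero[OF d] unfolding eq by (simp add: const3_simps)
  then show False using L(1) by simp
qed

text \<open>Every point of the curve on the line turns out to be sextactic. At T = 0 the equation of
  the curve reads 2 s^d + u^d = 0, which forces s \<noteq> 0, so that s can be scaled to 1.\<close>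

lemma sextactic_point_on_line_iff:
  assumes "L = const3 c * (X - Y)" "c \<noteq> 0"
  shows "P \<in> sextactic_points_on d L \<longleftrightarrow> (\<exists>w. w ^ d = -2 \<and> located P 1 0 w)"
proof -
  have hL: "homogeneous3 (Suc 0) L"
    unfolding assms(1) by (intro homogeneous3_const_mult homogeneous3_diff homS homT)
  have L_iff: "P \<in> V L \<longleftrightarrow> t = 0" if loc: "located P s t u" for s t u
  proof -
    obtain x y z where 1: "has_coords P x y z" "eval3 S x y z = s" "eval3 T x y z = t" "eval3 Z x y z = u"
      using loc by (auto simp: located_def)
    have "eval3 L x y z = c * (2 * t)"
      unfolding assms(1) by (simp add: eval3_XY 1)
    then show ?thesis using V_iff[OF hL 1(1)] assms(2) by simp
  qed
  show ?thesis
  proof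
    assume "P \<in> sextactic_points_on d L"
    then have PL: "P \<in> V L" and PF: "P \<in> V (fermat d)"
      by (auto simp: sextactic_points_on_def sextactic_point_def)
    obtain s t u where P: "located P s t u" "(s, t, u) \<noteq> (0, 0, 0)"
      by (rule located_exists)
    have t: "t = 0" using L_iff[OF P(1)] PL by simp
    have eq: "2 * s ^ d + u ^ d = 0" using in_V_fermat_iff[OF P(1)] PF t by simp
    have s: "s \<noteq> 0" using eq P(2) t d by (auto simp: power_0_left)
    then have "located P 1 0 (u / s)"
      using located_scale[OF P(1), of "1 / s"] t by simp
    moreover have "(u / s) ^ d = -2"
      using eq s by (simp add: power_divide field_simps) (simp add: eq_neg_iff_add_eq_0 add.commute)
    ultimately show "\<exists>w. w ^ d = -2 \<and> located P 1 0 w" by blast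
  next
    assume "\<exists>w. w ^ d = -2 \<and> located P 1 0 w"
    then obtain w where w: "w ^ d = -2" and P: "located P 1 0 w" by blast
    have "hyperosculating_conic (fermat d) P (conic w)"
      using hyperosculating_conic_iff[OF w P] by (auto simp: const3_simps intro!: exI[of _ 1])
    then show "P \<in> sextactic_points_on d L"
      using L_iff[OF P] in_V_fermat_iff[OF P] w not_inflection_point[OF w P]
      by (auto simp: sextactic_points_on_def sextactic_point_def)
  qed
qed

lemma card_sextactic_points:
  assumes "L = const3 c * (X - Y)" "c \<noteq> 0"
  shows "card (sextactic_points_on d L) = d"
proof -
  define pt where "pt w = (SOME P. located P 1 0 w)" for w
  have pt: "located (pt w) 1 0 w" for w
    unfolding pt_def using located_surj[of 1 0 w] by (auto intro: someI_ex)
  have "sextactic_points_on d L = pt ` {w. w ^ d = -2}"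
    using sextactic_point_on_line_iff[OF assms] pt located_unique_point by blast
  moreover have "inj_on pt {w. w ^ d = -2}"
  proof (rule inj_onI)
    fix w w' assume "pt w = pt w'"
    then have "located (pt w) 1 0 w'" using pt[of w'] by simp
    with pt[of w] obtain c where "1 = c * 1" "w' = c * w"
      by (rule located_unique_coords)
    then show "w = w'" by simp
  qed
  ultimately show ?thesis
    using card_nth_roots[of "-2" d] d by (simp add: card_image)
qed

section \<open>Common points of the hyperosculating conics\<close>

lemma common_points_iff:
  assumes "located P s t u"
  shows "(\<forall>w. w ^ d = -2 \<longrightarrow> P \<in> V (conic w)) \<longleftrightarrow> u = 0 \<and> (arc_k d - 1) * s ^ 2 = arc_a d * t ^ 2"
proof -
  \<comment> \<open>The equation of the conic at (s : t : u), as a polynomial in 1 / w.\<close>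
  define p where "p = [:(arc_k d - 1) * s ^ 2 - arc_a d * t ^ 2, (1 - 2 * arc_k d) * s * u, arc_k d * u ^ 2:]"
  have conic_p: "P \<in> V (conic w) \<longleftrightarrow> poly p (1 / w) = 0" for w
    unfolding in_V_conic_iff[OF assms] p_def by (simp add: divide_inverse power2_eq_square algebra_simps)
  have "p = 0" if "\<forall>w. w ^ d = -2 \<longrightarrow> P \<in> V (conic w)"
  proof (rule ccontr)
    assume "p \<noteq> 0"
    \<comment> \<open>The values 1 / w are the d-th roots of -1/2: at least three roots of a
      polynomial of degree at most 2.\<close>
    have "{e. e ^ d = - 1 / 2} \<subseteq> {e. poly p e = 0}"
    proof safe
      fix e :: complex assume e: "e ^ d = - 1 / 2"
      then have "(1 / e) ^ d = -2" by (simp add: power_one_over)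
      then show "poly p e = 0" using that conic_p[of "1 / e"] by simp
    qed
    then have "card {e :: complex. e ^ d = - 1 / 2} \<le> card {e. poly p e = 0}"
      by (intro card_mono poly_roots_finite \<open>p \<noteq> 0\<close>)
    also have "\<dots> \<le> degree p" by (rule card_poly_roots_bound[OF \<open>p \<noteq> 0\<close>])
    also have "\<dots> \<le> 2" by (simp add: p_def)
    finally show False using card_nth_roots[of "- 1 / 2" d] d by simp
  qed
  then show ?thesis
    unfolding conic_p using arc_k_nonzero[OF d] by (auto simp: p_def)
qed

lemma card_common_points:
  "card {P. \<forall>w. w ^ d = -2 \<longrightarrow> P \<in> V (conic w)} = (if d > 3 then 2 else 1)"
proof -
  note a0 = arc_a_nonzero[OF d]
  \<comment> \<open>The common points are (1 : r : 0) and (1 : -r : 0), which coincide exactly when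
    k = 1.\<close>
  define r where "r = csqrt ((arc_k d - 1) / arc_a d)"
  have r2: "r ^ 2 = (arc_k d - 1) / arc_a d" by (simp add: r_def)
  obtain P1 P2 where P1: "located P1 1 r 0" and P2: "located P2 1 (- r) 0"
    using located_surj by (metis one_neq_zero)
  have "P = P1 \<or> P = P2" if "\<forall>w. w ^ d = -2 \<longrightarrow> P \<in> V (conic w)" for P
  proof -
    obtain s t u where P: "located P s t u" "(s, t, u) \<noteq> (0, 0, 0)"
      by (rule located_exists)
    have u: "u = 0" and st: "(arc_k d - 1) * s ^ 2 = arc_a d * t ^ 2"
      using common_points_iff[OF P(1)] that by simp_all
    have s: "s \<noteq> 0" using st P(2) u a0 by auto
    have "(t / s) ^ 2 = r ^ 2"
      unfolding r2 using st s a0 by (simp add: field_simps)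
    then have "t / s = r \<or> t / s = - r" by (simp add: power2_eq_iff)
    moreover have "located P 1 (t / s) 0"
      using located_scale[OF P(1), of "1 / s"] s u by simp
    ultimately show ?thesis
      using located_unique_point P1 P2 by auto
  qed
  moreover have "\<forall>w. w ^ d = -2 \<longrightarrow> P1 \<in> V (conic w)" "\<forall>w. w ^ d = -2 \<longrightarrow> P2 \<in> V (conic w)"
    using common_points_iff[OF P1] common_points_iff[OF P2] a0 by (simp_all add: r2)
  ultimately have "{P. \<forall>w. w ^ d = -2 \<longrightarrow> P \<in> V (conic w)} = {P1, P2}" by blast
  moreover have "P1 = P2 \<longleftrightarrow> r = 0"
  proof
    assume "P1 = P2"
    then have "located P1 1 (- r) 0" using P2 by simp
    with P1 obtain c where "1 = c * 1" "- r = c * r" by (rule located_unique_coords)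
    then show "r = 0" by simp
  next
    assume "r = 0"
    then show "P1 = P2" using P1 P2 located_unique_point by simp
  qed
  moreover have "r = 0 \<longleftrightarrow> d = 3"
    using arc_k_eq_1_iff[OF d] a0 by (simp add: r_def)
  ultimately show ?thesis using d by auto
qed

text \<open>The hyperosculating conic at the point belonging to w is \<open>conic w\<close> up to a
  nonzero constant, so the quantifiers over points and conics amount to one over the roots w of w^d
  = -2.\<close>

lemma sextactic_and_common_points:
  assumes "L = const3 c * (X - Y)" "c \<noteq> 0"
  shows "card (sextactic_points_on d L) = d \<and>
    card {P. \<forall>p \<in> sextactic_points_on d L. \<forall>Q. hyperosculating_conic (fermat d) p Q \<longrightarrow> P \<in> V Q}
      = (if d > 3 then 2 else 1)"
proof -
  have V_conic: "V (const3 e * conic w) = V (conic w)" if "e \<noteq> 0" for e w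
    unfolding V_def using that by simp
  have "(\<forall>p \<in> sextactic_points_on d L. \<forall>Q. hyperosculating_conic (fermat d) p Q \<longrightarrow> P \<in> V Q)
      \<longleftrightarrow> (\<forall>w. w ^ d = -2 \<longrightarrow> P \<in> V (conic w))" for P
  proof
    assume *: "\<forall>p \<in> sextactic_points_on d L. \<forall>Q. hyperosculating_conic (fermat d) p Q \<longrightarrow> P \<in> V Q"
    show "\<forall>w. w ^ d = -2 \<longrightarrow> P \<in> V (conic w)"
    proof (intro allI impI)
      fix w :: complex assume w: "w ^ d = -2"
      obtain p where p: "located p 1 0 w" using located_surj[of 1 0 w] by auto
      have "hyperosculating_conic (fermat d) p (conic w)"
        using hyperosculating_conic_iff[OF w p] by (auto simp: const3_simps intro!: exI[of _ 1])
      then show "P \<in> V (conic w)"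
        using * sextactic_point_on_line_iff[OF assms] w p by blast
    qed
  next
    assume *: "\<forall>w. w ^ d = -2 \<longrightarrow> P \<in> V (conic w)"
    show "\<forall>p \<in> sextactic_points_on d L. \<forall>Q. hyperosculating_conic (fermat d) p Q \<longrightarrow> P \<in> V Q"
    proof (intro ballI allI impI)
      fix p Q assume p: "p \<in> sextactic_points_on d L" and Q: "hyperosculating_conic (fermat d) p Q"
      obtain w where w: "w ^ d = -2" "located p 1 0 w"
        using p sextactic_point_on_line_iff[OF assms] by blast
      then obtain e where "e \<noteq> 0" "Q = const3 e * conic w"
        using Q hyperosculating_conic_iff by blast
      then show "P \<in> V Q" using * w V_conic by simp
    qed
  qed
  then show ?thesis
    using card_sextactic_points[OF assms] card_common_points by simp
qed

end

section \<open>Lines of the arrangement\<close>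

lemma frame_var: "frame varx vary varz"
proof
  show "\<exists>a b c. varx = const3 a * varx + const3 b * vary + const3 c * varz"
    by (rule exI[of _ 1], rule exI[of _ 0], rule exI[of _ 0]) (simp add: const3_simps)
  show "\<exists>a b c. vary = const3 a * varx + const3 b * vary + const3 c * varz"
    by (rule exI[of _ 0], rule exI[of _ 1], rule exI[of _ 0]) (simp add: const3_simps)
  show "\<exists>a b c. varz = const3 a * varx + const3 b * vary + const3 c * varz"
    by (rule exI[of _ 0], rule exI[of _ 0], rule exI[of _ 1]) (simp add: const3_simps)
qed simp_all

lemma homogeneous3_arrangement: "homogeneous3 (d + d + d) (fermat_arrangement d)"
  unfolding fermat_arrangement_def using homogeneous3_power[OF homogeneous3_var(1), of d]
    homogeneous3_power[OF homogeneous3_var(2), of d] homogeneous3_power[OF homogeneous3_var(3), of d]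
  by (intro homogeneous3_mult homogeneous3_diff) simp_all

text \<open>Along a parametrised line the product defining the arrangement is a polynomial with all
  values zero, hence zero, so one of its factors vanishes identically. That factor identifies the
  line.\<close>

lemma arrangement_line_cases:
  assumes "d > 0" "is_line L" "V L \<subseteq> V (fermat_arrangement d)"
  obtains c m where "c \<noteq> 0" "m ^ d = 1"
    "L = const3 c * (varz - const3 m * varx) \<or> L = const3 c * (varz - const3 m * vary) \<or>
     L = const3 c * (vary - const3 m * varx)"
proof -
  have hL: "homogeneous3 (Suc 0) L" and L0: "L \<noteq> 0"
    using assms(2) by (auto simp: is_curve_def)
  obtain a b c where L: "L = const3 a * varx + const3 b * vary + const3 c * varz"
    using frame.linear_formE[OF frame_var hL] .
  have on_line: "(x ^ d - y ^ d) * (y ^ d - z ^ d) * (z ^ d - x ^ d) = 0"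
    if "(x, y, z) \<noteq> (0, 0, 0)" "a * x + b * y + c * z = 0" for x y z
  proof -
    have P: "has_coords (abs_proj_plane (x, y, z)) x y z"
      using that(1) by (simp add: has_coords_def)
    have "abs_proj_plane (x, y, z) \<in> V L"
      using V_iff[OF hL P] that(2) by (simp add: L)
    then have "abs_proj_plane (x, y, z) \<in> V (fermat_arrangement d)"
      using assms(3) by blast
    then show ?thesis
      using V_iff[OF homogeneous3_arrangement P] by (simp add: fermat_arrangement_def)
  qed
  define t where "t = [:0, 1 :: complex:]"
  have t_power: "poly (t ^ d) s = s ^ d" for s
    by (simp add: t_def)
  show ?thesis
  proof (cases "c = 0")
    case False
    define A B where "A = - a / c" and "B = - b / c"
    have a: "a = - A * c" and b: "b = - B * c" using False by (simp_all add: A_def B_def)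
    \<comment> \<open>The line is parametrised by (1 : s : A + B s). Either t^d = l^d, which forces
      A = 0, or l^d = 1, which forces l to be constant.\<close>
    define l where "l = [:A, B:]"
    have "poly ((1 - t ^ d) * (t ^ d - l ^ d) * (l ^ d - 1)) s = 0" for s
      using on_line[of 1 s "A + B * s"] by (simp add: t_def l_def a b algebra_simps)
    then have "(1 - t ^ d) * (t ^ d - l ^ d) * (l ^ d - 1) = 0"
      using poly_all_0_iff_0 by blast
    moreover have "1 - t ^ d \<noteq> 0"
    proof
      assume "1 - t ^ d = 0"
      then have "poly (1 - t ^ d) 0 = 0" by simp
      then show False using assms(1) by (simp add: t_def power_0_left)
    qed
    ultimately consider "t ^ d = l ^ d" | "l ^ d = 1" by auto
    then show ?thesis
    proof cases
      case 1
      have "A ^ d = 0" using arg_cong[OF 1, of "\<lambda>p. poly p 0"] assms(1) by (simp add: t_def l_def power_0_left)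
      then have A: "A = 0" by simp
      have "B ^ d = 1" using arg_cong[OF 1, of "\<lambda>p. poly p 1"] by (simp add: t_def l_def A)
      moreover have "L = const3 c * (varz - const3 B * vary)"
        unfolding L a b A by (simp add: const3_simps algebra_simps)
      ultimately show ?thesis using that False by blast
    next
      case 2
      have "degree (l ^ d) = d * degree l"
        by (rule degree_power_eq) (use 2 assms(1) in \<open>auto simp: power_0_left\<close>)
      then have B: "B = 0" using 2 assms(1) by (auto simp: l_def split: if_splits)
      have "A ^ d = 1" using arg_cong[OF 2, of "\<lambda>p. poly p 0"] by (simp add: l_def)
      moreover have "L = const3 c * (varz - const3 A * varx)"
        unfolding L a b B by (simp add: const3_simps algebra_simps)
      ultimately show ?thesis using that False by blast
    qed
  next
    case c: True
    have nonzero: "[:e:] - t ^ d \<noteq> 0" for e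
    proof
      assume *: "[:e:] - t ^ d = 0"
      have "poly ([:e:] - t ^ d) 0 = 0" "poly ([:e:] - t ^ d) 1 = 0" by (simp_all only: * poly_0)
      then show False using assms(1) by (simp add: t_def power_0_left)
    qed
    show ?thesis
    proof (cases "b = 0")
      case False
      \<comment> \<open>The line passes through (0 : 0 : 1) and is parametrised by (1 : m :
        s).\<close>
      define m where "m = - a / b"
      have a: "a = - m * b" using False by (simp add: m_def)
      have "poly ([:1 - m ^ d:] * ([:m ^ d:] - t ^ d) * ([:1:] - t ^ d)) s = 0" for s
        using on_line[of 1 m s] by (simp add: t_def a c)
      then have "[:1 - m ^ d:] * ([:m ^ d:] - t ^ d) * ([:1:] - t ^ d) = 0"
        using poly_all_0_iff_0 by blast
      then have "m ^ d = 1" using nonzero by simp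
      moreover have "L = const3 b * (vary - const3 m * varx)"
        unfolding L a c by (simp add: const3_simps algebra_simps)
      ultimately show ?thesis using that False by blast
    next
      case b: True
      \<comment> \<open>Here L is a multiple of x. On the points (0 : 1 : s) no factor vanishes
        identically, so this case is impossible.\<close>
      have "poly (([:1:] - t ^ d) * ([:0:] - t ^ d)) s = 0" for s
        using on_line[of 0 1 s] assms(1) by (simp add: t_def b c power_0_left)
      then have "([:1:] - t ^ d) * ([:0:] - t ^ d) = 0"
        using poly_all_0_iff_0 by blast
      then show ?thesis using nonzero[of 1] nonzero[of 0] by simp
    qed
  qed
qed

text \<open>Scaling a variable by a d-th root of unity preserves the Fermat equation. This symmetry,
  with permutations of the variables, brings every line of the arrangement to the form X =
  Y.\<close>

lemma fermat_frameI:
  assumes d: "d \<ge> 3" and m: "m ^ d = 1"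
    and XYZ: "{X, Y, Z} = {varx, vary, varz}"
    and surj: "\<And>p q r. \<exists>x y z. pull x y z X = p \<and> pull x y z Y = q \<and> pull x y z Z = r"
    and fermat: "fermat d = X ^ d + Y ^ d + Z ^ d"
  shows "fermat_frame X (const3 m * Y) Z d"
proof -
  have m0: "m \<noteq> 0" using m d by (auto simp: power_0_left)
  have m_inv: "const3 (1 / m) * (const3 m * Y) = Y"
    using m0 by (simp add: mult.assoc[symmetric] const3_simps(4)[symmetric] const3_simps(2))
  have "\<exists>a b c. v = const3 a * X + const3 b * (const3 m * Y) + const3 c * Z" if "v \<in> {X, Y, Z}" for v
  proof -
    have "X = const3 1 * X + const3 0 * (const3 m * Y) + const3 0 * Z"
      "Y = const3 0 * X + const3 (1 / m) * (const3 m * Y) + const3 0 * Z"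
      "Z = const3 0 * X + const3 0 * (const3 m * Y) + const3 1 * Z"
      unfolding m_inv by (simp_all add: const3_simps)
    then show ?thesis using that by blast
  qed
  then have span: "\<exists>a b c. v = const3 a * X + const3 b * (const3 m * Y) + const3 c * Z"
    if "v \<in> {varx, vary, varz}" for v
    using that unfolding XYZ by blast
  have "X \<in> {varx, vary, varz}" "Y \<in> {varx, vary, varz}" "Z \<in> {varx, vary, varz}"
    using XYZ by blast+
  then have hom: "homogeneous3 (Suc 0) X" "homogeneous3 (Suc 0) (const3 m * Y)" "homogeneous3 (Suc 0) Z"
    by (auto intro: homogeneous3_const_mult)
  have surj': "\<exists>x y z. pull x y z X = p \<and> pull x y z (const3 m * Y) = q \<and> pull x y z Z = r" for p q r
  proof -
    obtain x y z where "pull x y z X = p" "pull x y z Y = smult (1 / m) q" "pull x y z Z = r"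
      using surj by blast
    then have "pull x y z X = p \<and> pull x y z (const3 m * Y) = q \<and> pull x y z Z = r"
      using m0 by simp
    then show ?thesis by blast
  qed
  have "(const3 m * Y) ^ d = Y ^ d"
    by (simp only: power_mult_distrib const3_power[symmetric] m const3_simps(2) mult_1_left)
  then have fermat': "fermat d = X ^ d + (const3 m * Y) ^ d + Z ^ d"
    using fermat by simp
  show ?thesis
    by (intro fermat_frame.intro frame.intro fermat_frame_axioms.intro hom span d surj' fermat') simp_all
qed

theorem theorem4p10:
  fixes d :: nat and L :: poly3
  assumes "d \<ge> 3"
    and "is_line L" and "V L \<subseteq> V (fermat_arrangement d)"
  shows "card (sextactic_points_on d L) = d \<and>
    card {P. \<forall>p \<in> sextactic_points_on d L. \<forall>Q. hyperosculating_conic (fermat d) p Q \<longrightarrow> P \<in> V Q}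
      = (if d > 3 then 2 else 1)"
proof -
  obtain c m where c: "c \<noteq> 0" and m: "m ^ d = 1"
    and L: "L = const3 c * (varz - const3 m * varx) \<or> L = const3 c * (varz - const3 m * vary) \<or>
     L = const3 c * (vary - const3 m * varx)"
    using arrangement_line_cases[of d L] assms by auto
  \<comment> \<open>One frame for each shape of the line: in each, \<open>L\<close> is a constant
    times the first coordinate minus the second.\<close>
  have "fermat_frame varz (const3 m * varx) vary d" "fermat_frame varz (const3 m * vary) varx d"
    "fermat_frame vary (const3 m * varx) varz d"
    by (rule fermat_frameI[OF assms(1) m]; auto simp: fermat_def)+
  then show ?thesis
    using L c fermat_frame.sextactic_and_common_points by blast
qed

end
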